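(* Let $n\ge 1$ and let $\pi=\pi_1\pi_2\cdots\pi_n\in S_n$. The number of decreasing $\mathbb N$-trees (on $[n]$) with postorder $\pi$ is \[\sum_{\mathscr H\in\mathcal H(\pi)}\ \prod_{t=0}^{|\mathscr H|}C_{q_t(\mathscr H)-1},\] where $C_i$ is the $i$-th Catalan number.
   Context: Notation: $\mathbb N=\{0,1,2,\ldots\}$, $[m]=\{1,\ldots,m\}$; permutations in $S_n$ are written as words $\pi_1\cdots\pi_n$. A descent of $\pi$ is an index $i\in[n-1]$ with $\pi_i>\pi_{i+1}$. Trees. An $\mathbb N$-tree is a (nonempty, finite) rooted plane tree: a root together with a $j$-tuple (ordered left to right) of $\mathbb N$-trees for some $j\in\mathbb N$. A decreasing $\mathbb N$-tree on a finite set $X$ of positive integers is an $\mathbb N$-tree whose vertices are labeled bijectively by the elements of $X$ so that each nonroot vertex has a smaller label than its parent. The postorder of a tree $\tau$, denoted $P(\tau)$, is the word obtained by recursively reading the subtrees of the root in postorder from left to right and then reading the root. Valid hook configurations. The diagram of $\pi$ consists of the points $(i,\pi_i)$, $i\in[n]$. A hook $H$ is determined by indices $i<j$ with $\pi_i<\pi_j$: it is the union of the vertical segment from $(i,\pi_i)$ to $(i,\pi_j)$ and the horizontal segment from $(i,\pi_j)$ to $(j,\pi_j)$. Its southwest endpoint is ${}_eH=(i,\pi_i)$ and its northeast endpoint is $H^e=(j,\pi_j)$. A valid hook configuration of $\pi$ is an $m$-tuple $\mathscr H=(H_1,\ldots,H_m)$ ($m\ge 0$) of hooks in the diagram of $\pi$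 such that: (a) if ${}_eH_\ell=(i_\ell,\pi_{i_\ell})$ for each $\ell\in[m]$, then $i_1<i_2<\cdots<i_m$; (b) if $i$ is a descent of $\pi$, then $(i,\pi_i)={}_eH_\ell$ for some $\ell\in[m]$; (c) if $(j,\pi_j)=H_\ell^e$ for some $\ell\in[m]$, then there exist $\ell',\ell''\in[m]$ such that the $x$-coordinate of ${}_eH_{\ell'}$ is a descent of $\pi$, $(j-1,\pi_{j-1})={}_eH_{\ell''}$, and $H_{\ell'}^e=H_{\ell''}^e=(j,\pi_j)$; (d) if $\ell,\ell'\in[m]$, ${}_eH_\ell=(i,\pi_i)$, $H_\ell^e=(j,\pi_j)$, ${}_eH_{\ell'}=(i',\pi_{i'})$, $H_{\ell'}^e=(j',\pi_{j'})$, $\pi_j<\pi_{j'}$, and the real intervals $[i,j]$ and $[i',j']$ have more than one point in common, then $[i,j]\subseteq[i',j']$. The identity permutation has exactly one valid hook configuration, the empty one. Write $\mathcal H(\pi)$ for the set of valid hook configurations of $\pi$, $|\mathscr H|=m$ for the number of hooks, and $NE(\mathscr H)=\{H_1^e,\ldots,H_m^e\}$. Coloring. Given $\mathscr H=(H_1,\ldots,H_m)\in\mathcal H(\pi)$, color the points of the diagram with colors $c_0,\ldots,c_m$. The hook $H_\ell$ has color $c_\ell$; if ${}_eH_\ell=(i,\pi_i)$ and $H_\ell^e=(j,\pi_j)$, its top part is the segment from $(i+1/2,\pi_j)$ to $(j,\pi_j)$. If $(k,\pi_k)\in NE(\mathscr H)$, give $(k,\pi_k)$ the color $c_r$ where $r$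 is the largest index with $H_r^e=(k,\pi_k)$. Otherwise move directly upward from $(k,\pi_k)$ until first hitting the top part of a hook, and give $(k,\pi_k)$ the color of that hook; if several hooks are hit simultaneously, use the one whose southwest endpoint is farthest to the right; if no top part is hit, use $c_0$. Let $Q_t(\mathscr H)$ be the set of entries $\pi_\ell$ such that $(\ell,\pi_\ell)$ has color $c_t$, and $q_t(\mathscr H)=|Q_t(\mathscr H)|$. *)

theory Defs
  imports Complex_Main "HOL-Combinatorics.Permutations"
begin

datatype ntree = Node (label: nat) (children: "ntree list")

fun postorder :: "ntree \<Rightarrow> nat list" where
  "postorder (Node a ts) = concat (map postorder ts) @ [a]"

fun decreasing :: "ntree \<Rightarrow> bool" where
  "decreasing (Node a ts) \<longleftrightarrow> (\<forall>t\<in>set ts. label t < a \<and> decreasing t)"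

(* The postorder has one entry per vertex, so bijectivity of the labelling onto X says that
   it lists each element of X exactly once. *)
definition decreasing_ntrees_on :: "nat set \<Rightarrow> ntree set" where
  "decreasing_ntrees_on X =
     {t. decreasing t \<and> distinct (postorder t) \<and> set (postorder t) = X}"

(* Permutations of {1..n} are functions, with one-based positions. *)
definition word :: "nat \<Rightarrow> (nat \<Rightarrow> nat) \<Rightarrow> nat list" where
  "word n \<pi> = map \<pi> [1..<Suc n]"

definition descent :: "nat \<Rightarrow> (nat \<Rightarrow> nat) \<Rightarrow> nat \<Rightarrow> bool" where
  "descent n \<pi> i \<longleftrightarrow> i \<in> {1..<n} \<and> \<pi> i > \<pi> (Suc i)"

(* A hook is represented by the pair (i, j) of the x-coordinates of its southwest and
   northeast endpoints (i, \<pi> i) and (j, \<pi> j); a point of the diagram is determined by its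
   x-coordinate. *)
type_synonym hook = "nat \<times> nat"

abbreviation sw :: "hook \<Rightarrow> nat" where "sw \<equiv> fst"
abbreviation ne :: "hook \<Rightarrow> nat" where "ne \<equiv> snd"

definition is_hook :: "nat \<Rightarrow> (nat \<Rightarrow> nat) \<Rightarrow> hook \<Rightarrow> bool" where
  "is_hook n \<pi> h \<longleftrightarrow> 1 \<le> sw h \<and> sw h < ne h \<and> ne h \<le> n \<and> \<pi> (sw h) < \<pi> (ne h)"

definition span :: "hook \<Rightarrow> real set" where
  "span h = {real (sw h)..real (ne h)}"

definition valid_hook_configs :: "nat \<Rightarrow> (nat \<Rightarrow> nat) \<Rightarrow> hook list set" where
  "valid_hook_configs n \<pi> = {H.
     (\<forall>h\<in>set H. is_hook n \<pi> h) \<and>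
     sorted_wrt (<) (map sw H) \<and>
     (\<forall>i. descent n \<pi> i \<longrightarrow> (\<exists>h\<in>set H. sw h = i)) \<and>
     (\<forall>h\<in>set H. \<exists>h'\<in>set H. \<exists>h''\<in>set H.
        descent n \<pi> (sw h') \<and> Suc (sw h'') = ne h \<and> ne h' = ne h \<and> ne h'' = ne h) \<and>
     (\<forall>h\<in>set H. \<forall>h'\<in>set H.
        \<pi> (ne h) < \<pi> (ne h') \<and> (\<exists>x\<in>span h \<inter> span h'. \<exists>y\<in>span h \<inter> span h'. x \<noteq> y)
          \<longrightarrow> span h \<subseteq> span h')}"

(* Hooks of a configuration are numbered from 1, since the colour 0 belongs to no hook. *)
definition nth_hook :: "hook list \<Rightarrow> nat \<Rightarrow> hook" where
  "nth_hook H l = H ! (l - 1)"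

definition top_part :: "(nat \<Rightarrow> nat) \<Rightarrow> hook \<Rightarrow> (real \<times> real) set" where
  "top_part \<pi> h = {real (sw h) + 1/2..real (ne h)} \<times> {real (\<pi> (ne h))}"

definition hooks_above :: "(nat \<Rightarrow> nat) \<Rightarrow> hook list \<Rightarrow> nat \<Rightarrow> nat set" where
  "hooks_above \<pi> H k =
     {l\<in>{1..length H}. \<exists>y \<ge> real (\<pi> k). (real k, y) \<in> top_part \<pi> (nth_hook H l)}"

(* All indices of hooks whose top parts lie at the lowest height met from (k, \<pi> k). *)
definition first_hooks_above :: "(nat \<Rightarrow> nat) \<Rightarrow> hook list \<Rightarrow> nat \<Rightarrow> nat set" where
  "first_hooks_above \<pi> H k =
     {l. is_arg_min (\<lambda>l. \<pi> (ne (nth_hook H l))) (\<lambda>l. l \<in> hooks_above \<pi> H k) l}"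

(* Distinct hooks of a configuration have distinct southwest endpoints, so the maximiser in the
   last case is unique. *)
definition colour :: "(nat \<Rightarrow> nat) \<Rightarrow> hook list \<Rightarrow> nat \<Rightarrow> nat" where
  "colour \<pi> H k =
     (if k \<in> ne ` set H then Max {r\<in>{1..length H}. ne (nth_hook H r) = k}
      else if hooks_above \<pi> H k = {} then 0
      else (ARG_MAX (\<lambda>l. sw (nth_hook H l)) l. l \<in> first_hooks_above \<pi> H k))"

definition Q :: "nat \<Rightarrow> (nat \<Rightarrow> nat) \<Rightarrow> hook list \<Rightarrow> nat \<Rightarrow> nat set" where
  "Q n \<pi> H t = \<pi> ` {l\<in>{1..n}. colour \<pi> H l = t}"

(* In a valid hook configuration every colour 0, ..., length H occurs, so this number is
   positive and q n \<pi> H t - 1 is not truncated. *)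
definition q :: "nat \<Rightarrow> (nat \<Rightarrow> nat) \<Rightarrow> hook list \<Rightarrow> nat \<Rightarrow> nat" where
  "q n \<pi> H t = card (Q n \<pi> H t)"

(* The division is exact. *)
definition catalan :: "nat \<Rightarrow> nat" where
  "catalan i = (2 * i choose i) div (i + 1)"

text \<open>
  Finiteness of the two sets over which cardinalities and sums are taken below, so that the
  conventions of \<^const>\<open>card\<close> and \<^const>\<open>sum\<close> for infinite sets play no role.
\<close>

lemma postorder_nonempty: "postorder t \<noteq> []"
  by (cases t) simp

lemma length_le_length_concat_postorder: "length ts \<le> length (concat (map postorder ts))"
proof (induction ts)
  case (Cons t ts)
  have "1 \<le> length (postorder t)"
    using postorder_nonempty[of t] by (cases "postorder t") auto
  with Cons show ?case by simp
qed simp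

lemma length_postorder_child:
  "t \<in> set ts \<Longrightarrow> length (postorder t) \<le> length (concat (map postorder ts))"
  by (induction ts) auto

lemma finite_ntrees_length_postorder:
  assumes "finite X"
  shows "finite {t. length (postorder t) \<le> m \<and> set (postorder t) \<subseteq> X}"
proof (induction m)
  case 0
  then show ?case by (simp add: postorder_nonempty)
next
  case (Suc m)
  let ?F = "{t. length (postorder t) \<le> m \<and> set (postorder t) \<subseteq> X}"
  have "{t. length (postorder t) \<le> Suc m \<and> set (postorder t) \<subseteq> X}
      \<subseteq> (\<lambda>(a, ts). Node a ts) ` (X \<times> {ts. set ts \<subseteq> ?F \<and> length ts \<le> m})"
  proof
    fix t assume t: "t \<in> {t. length (postorder t) \<le> Suc m \<and> set (postorder t) \<subseteq> X}"
    obtain a ts where [simp]: "t = Node a ts" by (cases t)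
    have len: "length (concat (map postorder ts)) \<le> m" and "a \<in> X"
      and sub: "set (concat (map postorder ts)) \<subseteq> X"
      using t by auto
    moreover have "length ts \<le> m"
      using length_le_length_concat_postorder[of ts] len by linarith
    moreover have "set ts \<subseteq> ?F"
    proof
      fix s assume s: "s \<in> set ts"
      have "length (postorder s) \<le> m"
        using length_postorder_child[OF s] len by linarith
      moreover have "set (postorder s) \<subseteq> X" using sub s by auto
      ultimately show "s \<in> ?F" by simp
    qed
    ultimately show "t \<in> (\<lambda>(a, ts). Node a ts) ` (X \<times> {ts. set ts \<subseteq> ?F \<and> length ts \<le> m})"
      by auto
  qed
  moreover have "finite (X \<times> {ts. set ts \<subseteq> ?F \<and> length ts \<le> m})"
    using assms Suc finite_lists_length_le by blast
  ultimately show ?case by (meson finite_imageI finite_subset)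
qed

lemma finite_decreasing_ntrees_on:
  assumes "finite X"
  shows "finite (decreasing_ntrees_on X)"
proof (rule finite_subset)
  show "decreasing_ntrees_on X
      \<subseteq> {t. length (postorder t) \<le> card X \<and> set (postorder t) \<subseteq> X}"
    unfolding decreasing_ntrees_on_def by (auto simp: distinct_card[symmetric])
qed (rule finite_ntrees_length_postorder[OF assms])

lemma finite_valid_hook_configs: "finite (valid_hook_configs n \<pi>)"
proof (rule finite_subset)
  show "valid_hook_configs n \<pi> \<subseteq> {H. set H \<subseteq> {1..n} \<times> {1..n} \<and> distinct H}"
  proof
    fix H assume H: "H \<in> valid_hook_configs n \<pi>"
    have "distinct H"
      using H strict_sorted_iff[of "map sw H"]
      by (auto simp: valid_hook_configs_def distinct_map)
    moreover have "set H \<subseteq> {1..n} \<times> {1..n}"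
      using H by (fastforce simp: valid_hook_configs_def is_hook_def)
    ultimately show "H \<in> {H. set H \<subseteq> {1..n} \<times> {1..n} \<and> distinct H}" by simp
  qed
  show "finite {H. set H \<subseteq> {1..n} \<times> {1..n} \<and> distinct H}"
    by (rule finite_subset_distinct) simp
qed

end

theory Submission
  imports Defs
begin

text \<open>
  Let T(l, r) be the number of trees with postorder \<open>\<pi>\<^sub>l \<dots> \<pi>\<^sub>r\<close>. Detaching the leftmost subtree
  of the root gives T(r, r) = 1 and, for l < r, T(l, r) = sum of T(l, m) T(m + 1, r) over all m
  with l \<le> m < r and \<open>\<pi>\<^sub>m < \<pi>\<^sub>r\<close>. The weighted count V(l, r) of hook configurations on the block from
  l to r satisfies the same recursion. If r is a northeast endpoint, cut the block at the leftmost
  hook ending in r. Dropping the requirement that some hook ending in r starts at a descent, this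
  cut yields exactly the recursion above; what has to be seen is that the superfluous
  configurations (all hooks ending in r start at ascents) weigh as much in total as the valid
  configurations in which r is not a northeast endpoint. Both totals satisfy one and the same
  recursion, for the latter by the Catalan convolution applied to the size of the colour class 0,
  whose proper cuts are the positions at which the block splits without cutting a hook.
\<close>

section \<open>Catalan numbers\<close>

text \<open>The ratio of consecutive central binomials; in \<open>catalan_Suc\<close> it turns
  shifted terms into rational multiples of unshifted ones.\<close>

lemma central_binomial_Suc:
  "Suc i * (2 * Suc i choose Suc i) = 2 * (2 * i + 1) * (2 * i choose i)"
proof -
  have "Suc i * (2 * Suc i choose Suc i) = Suc i * (2 * (Suc (2 * i) choose i))"
    using Suc_times_binomial[of i "Suc (2 * i)"]
    by (simp add: algebra_simps del: binomial_Suc_Suc)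
  then have "2 * Suc i choose Suc i = 2 * (Suc (2 * i) choose i)"
    by (simp only: Suc_mult_cancel1)
  also have "Suc (2 * i) choose i = Suc (2 * i) choose Suc i"
    using binomial_symmetric[of i "Suc (2 * i)"] by (simp del: binomial_Suc_Suc)
  finally show ?thesis
    using Suc_times_binomial[of i "2 * i"] by (simp del: binomial_Suc_Suc)
qed

text \<open>The division is exact: \<open>i + 1\<close> times the difference of
  \<open>2 * i choose i\<close> and \<open>2 * i choose Suc i\<close> is
  \<open>2 * i choose i\<close>.\<close>

lemma real_catalan: "real (catalan i) = real (2 * i choose i) / real (i + 1)"
proof -
  have "Suc i * (2 * i choose Suc i) = 2 * i * (2 * i - 1 choose i)"
    by (rule binomial_absorption)
  also have "\<dots> = (2 * i - i) * (2 * i choose i)"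
    by (rule binomial_absorb_comp[symmetric])
  finally have "(i + 1) * ((2 * i choose i) - (2 * i choose Suc i)) = (2 * i choose i)"
    by (simp add: diff_mult_distrib2)
  then have "(i + 1) dvd (2 * i choose i)" by (rule dvdI[OF sym])
  then show ?thesis unfolding catalan_def by (rule real_of_nat_div)
qed

lemma catalan_0 [simp]: "catalan 0 = 1"
  by (simp add: catalan_def)

text \<open>One telescoping step of \<open>catalan_Suc\<close>: \<open>x\<close> and
  \<open>y\<close> stand for \<open>i\<close> and \<open>n - i\<close>, and \<open>b\<close> and
  \<open>d\<close> for their central binomials. The factors
  \<open>2 * (2 * x + 1) * b / (x + 1)\<close> and its analogue in \<open>y\<close> are the next
  central binomials.\<close>

lemma gosper_identity:
  fixes x y b d :: real
  assumes "x \<ge> 0" "y \<ge> 0"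
  shows "b / (x + 1) * (d / (y + 1)) =
    2 * (2 * x + 1) * b / (x + 1) * d * (x - y + 1) / (2 * ((x + y + 1) * (x + y + 2))) -
    b * (2 * (2 * y + 1) * d / (y + 1)) * (x - y - 1) / (2 * ((x + y + 1) * (x + y + 2)))"
proof -
  define u v p where "u = x + 1" and "v = y + 1" and "p = (x + y + 1) * (x + y + 2)"
  have nz: "u \<noteq> 0" "v \<noteq> 0" "p \<noteq> 0" using assms by (auto simp: u_def v_def p_def)
  \<comment> \<open>Clearing denominators leaves only this polynomial identity.\<close>
  have "p = (2 * x + 1) * (x - y + 1) * v - (2 * y + 1) * (x - y - 1) * u"
    by (simp add: u_def v_def p_def algebra_simps)
  then have "b * d * p / (u * v * p) =
      b * d * ((2 * x + 1) * (x - y + 1) * v - (2 * y + 1) * (x - y - 1) * u) / (u * v * p)"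
    by simp
  also have "\<dots> = b * d * ((2 * x + 1) * (x - y + 1)) / (u * p)
      - b * d * ((2 * y + 1) * (x - y - 1)) / (v * p)"
  proof -
    have "b * d * (s * v - t * u) / (u * v * p) = b * d * s / (u * p) - b * d * t / (v * p)" for s t
      using nz by (simp add: field_simps)
    then show ?thesis by simp
  qed
  also have "\<dots> = 2 * (2 * x + 1) * b / u * d * (x - y + 1) / (2 * p) -
      b * (2 * (2 * y + 1) * d / v) * (x - y - 1) / (2 * p)"
  proof -
    have "b * d * (s * t) / (w * p) = 2 * s * b / w * d * t / (2 * p)"
      "b * d * (s * t) / (w * p) = b * (2 * s * d / w) * t / (2 * p)" for s t w
      by (simp_all add: mult_ac)
    then show ?thesis by presburger
  qed
  finally show ?thesis using nz by (simp flip: u_def v_def p_def)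
qed

text \<open>The summand is telescoped by \<open>g\<close> below, which Gosper's algorithm finds.\<close>

lemma catalan_Suc: "catalan (Suc n) = (\<Sum>i\<le>n. catalan i * catalan (n - i))"
proof -
  define b where "b i = real (2 * i choose i)" for i
  define g where "g i = b i * b (Suc n - i) * (2 * real i - real (Suc n))
      / (2 * real (Suc n) * real (n + 2))" for i
  have b_Suc: "b (Suc i) = 2 * (2 * real i + 1) * b i / (real i + 1)" for i
    using central_binomial_Suc[of i, THEN arg_cong[where f = real]]
    unfolding b_def of_nat_mult by (simp add: field_simps)
  have "b 0 = 1" by (simp add: b_def)
  have step: "real (catalan i * catalan (n - i)) = g (Suc i) - g i" if "i \<le> n" for i
  proof -
    define d where "d = n - i"
    have n: "n = i + d" and "Suc n - i = Suc d" "Suc n - Suc i = d"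
      using that by (auto simp: d_def)
    then have "g (Suc i) = b (Suc i) * b d * (real i - real d + 1)
        / (2 * ((real i + real d + 1) * (real i + real d + 2)))"
      "g i = b i * b (Suc d) * (real i - real d - 1)
        / (2 * ((real i + real d + 1) * (real i + real d + 2)))"
      unfolding g_def by (simp_all add: n algebra_simps)
    moreover have "real (catalan i * catalan (n - i)) = b i / (real i + 1) * (b d / (real d + 1))"
      by (simp add: real_catalan b_def d_def ac_simps)
    ultimately show ?thesis
      using gosper_identity[of "real i" "real d" "b i" "b d"] by (simp only: b_Suc of_nat_0_le_iff)
  qed
  have "real (\<Sum>i\<le>n. catalan i * catalan (n - i)) = (\<Sum>i<Suc n. g (Suc i) - g i)"
    unfolding of_nat_sum lessThan_Suc_atMost by (intro sum.cong refl step) simp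
  also have "\<dots> = g (Suc n) - g 0" by (rule sum_lessThan_telescope)
  \<comment> \<open>\<open>g\<close> changes sign when \<open>i\<close> is replaced by
    \<open>Suc n - i\<close>, so the two boundary terms contribute equally.\<close>
  also have "\<dots> = b (Suc n) / real (n + 2)"
    by (simp add: g_def \<open>b 0 = 1\<close> divide_simps) (simp add: algebra_simps)
  also have "\<dots> = real (catalan (Suc n))" unfolding real_catalan b_def by simp
  finally show ?thesis by (metis of_nat_eq_iff)
qed

section \<open>Trees\<close>

definition word_trees :: "(nat \<Rightarrow> nat) \<Rightarrow> nat \<Rightarrow> nat \<Rightarrow> ntree set" where
  "word_trees \<pi> l r = {t. decreasing t \<and> postorder t = map \<pi> [l..<Suc r]}"

lemma last_postorder: "last (postorder t) = label t"
  by (cases t) simp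

lemma label_word_trees: "t \<in> word_trees \<pi> l r \<Longrightarrow> l \<le> r \<Longrightarrow> label t = \<pi> r"
  by (auto simp: word_trees_def simp flip: last_postorder)

lemma finite_word_trees: "finite (word_trees \<pi> l r)"
proof (rule finite_subset)
  show "word_trees \<pi> l r \<subseteq>
      {t. length (postorder t) \<le> Suc r - l \<and> set (postorder t) \<subseteq> \<pi> ` {l..r}}"
    by (auto simp: word_trees_def)
qed (simp add: finite_ntrees_length_postorder)

lemma concat_postorder_eq_Nil: "concat (map postorder ts) = [] \<longleftrightarrow> ts = []"
  using postorder_nonempty by (cases ts) auto

lemma word_trees_singleton: "word_trees \<pi> r r = {Node (\<pi> r) []}"
proof (intro equalityI subsetI)
  fix t assume t: "t \<in> word_trees \<pi> r r"
  obtain a ts where [simp]: "t = Node a ts" by (cases t)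
  have "concat (map postorder ts) = []" "a = \<pi> r" using t by (simp_all add: word_trees_def)
  then show "t \<in> {Node (\<pi> r) []}" by (simp only: concat_postorder_eq_Nil) simp
qed (simp add: word_trees_def)

lemma map_upt_eq_appendD:
  assumes eq: "map f [l..<r] = xs @ ys" and "l \<le> r"
  shows "l + length xs + length ys = r"
    and "xs = map f [l..<l + length xs]" and "ys = map f [l + length xs..<r]"
proof -
  have "length (map f [l..<r]) = length (xs @ ys)" by (simp only: eq)
  then show len: "l + length xs + length ys = r" using \<open>l \<le> r\<close> by simp
  have "xs = take (length xs) (map f [l..<r])" by (simp add: eq)
  then show "xs = map f [l..<l + length xs]"
    using len by (simp add: take_map)
  have "ys = drop (length xs) (map f [l..<r])" by (simp add: eq)
  then show "ys = map f [l + length xs..<r]" by (simp add: drop_map)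
qed

text \<open>Inverse of detaching the leftmost child. The postorder of that child is a prefix of the
  whole postorder, so grafting corresponds to concatenating words.\<close>

fun graft :: "ntree \<Rightarrow> ntree \<Rightarrow> ntree" where
  "graft t (Node a ts) = Node a (t # ts)"

lemma postorder_graft: "postorder (graft t u) = postorder t @ postorder u"
  by (cases u) simp

lemma decreasing_graft: "decreasing (graft t u) \<longleftrightarrow> label t < label u \<and> decreasing t \<and> decreasing u"
  by (cases u) auto

lemma graft_eq_iff: "graft t u = graft t' u' \<longleftrightarrow> t = t' \<and> u = u'"
  by (cases u; cases u') auto

text \<open>The postorder of \<open>t\<close> is a proper prefix of the block. Its last position
  \<open>m\<close> carries the root of \<open>t\<close>, so the only new label condition, along the
  edge from \<open>t\<close> to the root, is \<open>\<pi> m < \<pi> r\<close>.\<close>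

lemma graft_mem_word_trees_iff:
  assumes "l < r"
  shows "graft t u \<in> word_trees \<pi> l r \<longleftrightarrow>
    (\<exists>m\<in>{l..<r}. \<pi> m < \<pi> r \<and> t \<in> word_trees \<pi> l m \<and> u \<in> word_trees \<pi> (Suc m) r)"
proof
  assume "graft t u \<in> word_trees \<pi> l r"
  then have dec: "label t < label u" "decreasing t" "decreasing u"
    and eq: "map \<pi> [l..<Suc r] = postorder t @ postorder u"
    by (auto simp: word_trees_def decreasing_graft postorder_graft)
  \<comment> \<open>The position of the root of \<open>t\<close>; a postorder is nonempty, so the
    subtraction does not truncate.\<close>
  define m where "m = l + length (postorder t) - 1"
  have m: "l + length (postorder t) = Suc m"
    using postorder_nonempty[of t] by (simp add: m_def)
  have ne: "length (postorder u) > 0" using postorder_nonempty[of u] by simp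
  have "Suc m + length (postorder u) = Suc r"
    and t: "postorder t = map \<pi> [l..<Suc m]" and u: "postorder u = map \<pi> [Suc m..<Suc r]"
    using map_upt_eq_appendD[OF eq, unfolded m] assms by (simp_all del: upt_Suc)
  then have "m < r" using ne by linarith
  have "l \<le> m" using m postorder_nonempty[of t] by (cases "postorder t") auto
  have tu: "t \<in> word_trees \<pi> l m" "u \<in> word_trees \<pi> (Suc m) r"
    using t u dec by (auto simp: word_trees_def)
  with dec(1) have "\<pi> m < \<pi> r"
    using \<open>m < r\<close> \<open>l \<le> m\<close> by (auto simp: label_word_trees)
  then show "\<exists>m\<in>{l..<r}. \<pi> m < \<pi> r \<and> t \<in> word_trees \<pi> l m \<and> u \<in> word_trees \<pi> (Suc m) r"
    using tu \<open>m < r\<close> \<open>l \<le> m\<close> by auto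
next
  assume "\<exists>m\<in>{l..<r}. \<pi> m < \<pi> r \<and> t \<in> word_trees \<pi> l m \<and> u \<in> word_trees \<pi> (Suc m) r"
  then obtain m where m: "l \<le> m" "m < r" "\<pi> m < \<pi> r"
    and t: "t \<in> word_trees \<pi> l m" and u: "u \<in> word_trees \<pi> (Suc m) r" by auto
  have "label t < label u" using label_word_trees[OF t] label_word_trees[OF u] m by simp
  moreover have "[l..<Suc r] = [l..<Suc m] @ [Suc m..<Suc r]"
    using m upt_add_eq_append[of l "Suc m" "r - m"] by (simp del: upt_Suc)
  ultimately show "graft t u \<in> word_trees \<pi> l r"
    using t u by (simp add: word_trees_def decreasing_graft postorder_graft del: upt_Suc)
qed

text \<open>A tree with more than one vertex is a graft in exactly one way, and \<open>m\<close> can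
  be read off from the number of vertices of the detached subtree.\<close>

lemma card_word_trees_rec:
  assumes "l < r"
  shows "card (word_trees \<pi> l r) =
    (\<Sum>m\<in>{m\<in>{l..<r}. \<pi> m < \<pi> r}. card (word_trees \<pi> l m) * card (word_trees \<pi> (Suc m) r))"
proof -
  let ?M = "{m\<in>{l..<r}. \<pi> m < \<pi> r}"
  let ?P = "SIGMA m:?M. word_trees \<pi> l m \<times> word_trees \<pi> (Suc m) r"
  let ?g = "\<lambda>(m :: nat, t, u). graft t u"
  have inj: "inj_on ?g ?P"
  proof (rule inj_onI, clarify)
    fix m m' t t' u u'
    assume "t \<in> word_trees \<pi> l m" "t' \<in> word_trees \<pi> l m'"
      and m: "m \<in> {l..<r}" "m' \<in> {l..<r}" and eq: "graft t u = graft t' u'"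
    then have "length (postorder t) = Suc m - l" "length (postorder t') = Suc m' - l"
      by (simp_all add: word_trees_def del: upt_Suc)
    moreover have "t = t'" "u = u'" using eq by (simp_all add: graft_eq_iff)
    ultimately show "m = m' \<and> (t, u) = (t', u')" using m by auto
  qed
  have "?g ` ?P = word_trees \<pi> l r"
  proof (intro equalityI subsetI)
    fix s assume s: "s \<in> word_trees \<pi> l r"
    obtain a ts where "s = Node a ts" by (cases s)
    moreover have "ts \<noteq> []"
    proof
      assume "ts = []"
      then have "map \<pi> [l..<Suc r] = [a]" using s \<open>s = Node a ts\<close> by (simp add: word_trees_def)
      then have "length (map \<pi> [l..<Suc r]) = length [a]" by (simp only:)
      then show False using assms by simp
    qed
    ultimately obtain t u where "s = graft t u"
      by (metis graft.simps list.exhaust)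
    moreover obtain m where "m \<in> ?M" "t \<in> word_trees \<pi> l m" "u \<in> word_trees \<pi> (Suc m) r"
      using s \<open>s = graft t u\<close> graft_mem_word_trees_iff[OF assms, of t u \<pi>] by blast
    ultimately show "s \<in> ?g ` ?P" by (intro image_eqI[of _ _ "(m, t, u)"]) simp_all
  next
    fix s assume "s \<in> ?g ` ?P"
    then obtain m t u where "s = graft t u" "m \<in> ?M"
      "t \<in> word_trees \<pi> l m" "u \<in> word_trees \<pi> (Suc m) r" by auto
    then show "s \<in> word_trees \<pi> l r" using graft_mem_word_trees_iff[OF assms] by blast
  qed
  then have "card (word_trees \<pi> l r) = card ?P" using card_image[OF inj] by (simp only:)
  then show ?thesis by (simp add: card_SigmaI finite_word_trees card_cartesian_product)
qed

section \<open>Hook configurations on blocks\<close>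

text \<open>Nesting is expressed by positions, whereas condition (d) compares heights;
  \<open>valid_hook_configs_iff\<close> reconciles the two. The case \<open>i = i'\<close> of the
  nesting clause makes the southwest endpoint determine the hook.\<close>

definition noncrossing :: "(nat \<Rightarrow> nat) \<Rightarrow> nat \<Rightarrow> nat \<Rightarrow> hook set \<Rightarrow> bool" where
  "noncrossing \<pi> l r S \<longleftrightarrow>
    (\<forall>i j. (i, j) \<in> S \<longrightarrow> l \<le> i \<and> i < j \<and> j \<le> r \<and> \<pi> i < \<pi> j) \<and>
    (\<forall>i j i' j'. (i, j) \<in> S \<longrightarrow> (i', j') \<in> S \<longrightarrow> i \<le> i' \<longrightarrow> i' < j \<longrightarrow> j' \<le> j) \<and>
    (\<forall>i. l \<le> i \<longrightarrow> i < r \<longrightarrow> \<pi> (Suc i) < \<pi> i \<longrightarrow> (\<exists>j. (i, j) \<in> S))"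

text \<open>Condition (c) at a northeast endpoint \<open>j\<close>.\<close>

definition closed_at :: "(nat \<Rightarrow> nat) \<Rightarrow> hook set \<Rightarrow> nat \<Rightarrow> bool" where
  "closed_at \<pi> S j \<longleftrightarrow> (j - 1, j) \<in> S \<and> (\<exists>i. (i, j) \<in> S \<and> \<pi> (Suc i) < \<pi> i)"

definition hook_sets :: "(nat \<Rightarrow> nat) \<Rightarrow> nat \<Rightarrow> nat \<Rightarrow> hook set set" where
  "hook_sets \<pi> l r = {S. noncrossing \<pi> l r S \<and> (\<forall>i j. (i, j) \<in> S \<longrightarrow> closed_at \<pi> S j)}"

text \<open>Here r acts as a northeast endpoint, but no hook ending there need start at a descent.\<close>

definition rooted_hook_sets ::
  "(nat \<Rightarrow> nat) \<Rightarrow> (nat \<Rightarrow> bool) \<Rightarrow> nat \<Rightarrow> nat \<Rightarrow> hook set set" where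
  "rooted_hook_sets \<pi> P l r = {S. noncrossing \<pi> l r S \<and>
    (\<forall>i j. (i, j) \<in> S \<longrightarrow> j < r \<longrightarrow> closed_at \<pi> S j) \<and>
    (l < r \<longrightarrow> (r - 1, r) \<in> S) \<and> (\<forall>i. (i, r) \<in> S \<longrightarrow> P i)}"

definition open_hook_sets :: "(nat \<Rightarrow> nat) \<Rightarrow> nat \<Rightarrow> nat \<Rightarrow> hook set set" where
  "open_hook_sets \<pi> l r = {S \<in> hook_sets \<pi> l r. \<forall>i. (i, r) \<notin> S}"

text \<open>Colour classes: \<open>uncovered S 1 n\<close> is the class of colour 0, and that of a hook (i, j) is
  \<open>uncovered S (Suc i) j\<close>.\<close>

definition uncovered :: "hook set \<Rightarrow> nat \<Rightarrow> nat \<Rightarrow> nat set" where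
  "uncovered S l r = {k\<in>{l..r}. \<forall>i j. (i, j) \<in> S \<longrightarrow> l \<le> i \<longrightarrow> i < k \<longrightarrow> j < k}"

text \<open>The Catalan factors of the colours that belong to hooks; \<open>weight\<close> supplies
  the factor of colour 0.\<close>

definition hook_weight :: "hook set \<Rightarrow> nat" where
  "hook_weight S = (\<Prod>h\<in>S. catalan (card (uncovered S (Suc (sw h)) (ne h)) - 1))"

definition weight :: "nat \<Rightarrow> nat \<Rightarrow> hook set \<Rightarrow> nat" where
  "weight l r S = catalan (card (uncovered S l r) - 1) * hook_weight S"

text \<open>In a \<open>noncrossing\<close> set, a hook that starts at \<open>m\<close> belongs
  neither to this part nor to \<open>right_part m S\<close>.\<close>

definition left_part :: "nat \<Rightarrow> hook set \<Rightarrow> hook set" where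
  "left_part m S = {h \<in> S. ne h \<le> m}"

definition right_part :: "nat \<Rightarrow> hook set \<Rightarrow> hook set" where
  "right_part m S = {h \<in> S. m < sw h}"

section \<open>Elementary properties of noncrossing hook sets\<close>

lemma noncrossingI:
  assumes "\<And>i j. (i, j) \<in> S \<Longrightarrow> l \<le> i \<and> i < j \<and> j \<le> r \<and> \<pi> i < \<pi> j"
    and "\<And>i j i' j'. (i, j) \<in> S \<Longrightarrow> (i', j') \<in> S \<Longrightarrow> i \<le> i' \<Longrightarrow> i' < j \<Longrightarrow> j' \<le> j"
    and "\<And>i. l \<le> i \<Longrightarrow> i < r \<Longrightarrow> \<pi> (Suc i) < \<pi> i \<Longrightarrow> \<exists>j. (i, j) \<in> S"
  shows "noncrossing \<pi> l r S"
  unfolding noncrossing_def using assms by simp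

lemma noncrossingD:
  assumes "noncrossing \<pi> l r S" "(i, j) \<in> S"
  shows "l \<le> i" "i < j" "j \<le> r" "\<pi> i < \<pi> j"
  using assms unfolding noncrossing_def by blast+

lemma noncrossing_nested:
  "noncrossing \<pi> l r S \<Longrightarrow> (i, j) \<in> S \<Longrightarrow> (i', j') \<in> S \<Longrightarrow> i \<le> i' \<Longrightarrow> i' < j \<Longrightarrow> j' \<le> j"
  unfolding noncrossing_def by blast

lemma noncrossing_fun:
  assumes "noncrossing \<pi> l r S" "(i, j) \<in> S" "(i, j') \<in> S"
  shows "j = j'"
  using noncrossing_nested[OF assms] noncrossing_nested[OF assms(1,3,2)]
    noncrossingD(2)[OF assms(1)] assms(2,3) by (simp add: le_antisym)

lemma noncrossing_descent:
  assumes "noncrossing \<pi> l r S" "l \<le> i" "i < r" "\<pi> (Suc i) < \<pi> i"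
  shows "\<exists>j. (i, j) \<in> S"
  using assms unfolding noncrossing_def by blast

lemma noncrossing_subset: "noncrossing \<pi> l r S \<Longrightarrow> S \<subseteq> {l..r} \<times> {l..r}"
  unfolding noncrossing_def by force

lemma noncrossing_finite: "noncrossing \<pi> l r S \<Longrightarrow> finite S"
  by (rule finite_subset[OF noncrossing_subset]) auto

lemma finite_noncrossing_sets: "finite {S. noncrossing \<pi> l r S}"
  by (rule finite_subset[of _ "Pow ({l..r} \<times> {l..r})"]) (auto dest!: noncrossing_subset)

lemma noncrossing_singleton: "noncrossing \<pi> r r S \<longleftrightarrow> S = {}"
  unfolding noncrossing_def by fastforce

lemma finite_hook_sets [simp]:
  "finite (hook_sets \<pi> l r)" "finite (rooted_hook_sets \<pi> P l r)" "finite (open_hook_sets \<pi> l r)"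
  unfolding hook_sets_def rooted_hook_sets_def open_hook_sets_def
  by (auto intro!: finite_subset[OF _ finite_noncrossing_sets[of \<pi> l r]])

text \<open>The last position whose entry exceeds the final one would be a descent, and its hook would end
  at a later such position.\<close>

lemma noncrossing_last_max:
  assumes "inj \<pi>" and S: "noncrossing \<pi> l r S" and "l \<le> k" "k < r"
  shows "\<pi> k < \<pi> r"
proof (rule ccontr)
  assume "\<not> \<pi> k < \<pi> r"
  moreover have "\<pi> k \<noteq> \<pi> r" using \<open>inj \<pi>\<close> \<open>k < r\<close> by (auto dest: injD)
  ultimately have "\<pi> r < \<pi> k" by simp
  let ?K = "{k. l \<le> k \<and> k < r \<and> \<pi> r < \<pi> k}"
  define m where "m = Max ?K"
  have fin: "finite ?K" by simp
  have "k \<in> ?K" using assms \<open>\<pi> r < \<pi> k\<close> by simp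
  then have m: "l \<le> m" "m < r" "\<pi> r < \<pi> m"
    using Max_in[OF fin] unfolding m_def by blast+
  have max: "k' \<le> m" if "l \<le> k'" "k' < r" "\<pi> r < \<pi> k'" for k'
    using Max_ge[OF fin, of k'] that unfolding m_def by simp
  have "\<not> \<pi> r < \<pi> (Suc m)"
    using max[of "Suc m"] m by (cases "Suc m = r") auto
  then have "\<pi> (Suc m) < \<pi> m" using m by simp
  then obtain j where j: "(m, j) \<in> S" using noncrossing_descent[OF S m(1,2)] by blast
  have "\<pi> r < \<pi> j" using noncrossingD(4)[OF S j] m by simp
  then have "j \<noteq> r" by auto
  then show False using noncrossingD[OF S j] max[of j] m \<open>\<pi> r < \<pi> j\<close> by simp
qed

text \<open>Hooks starting strictly under a hook also end under it, by nesting. This makes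
  \<open>noncrossing_last_max\<close> applicable below any hook.\<close>

lemma noncrossing_below_hook:
  assumes S: "noncrossing \<pi> l r S" and ij: "(i, j) \<in> S"
  shows "noncrossing \<pi> (Suc i) j {h \<in> S. i < sw h \<and> sw h < j}"
proof -
  have "\<exists>j'. (k, j') \<in> S" if "Suc i \<le> k" "k < j" "\<pi> (Suc k) < \<pi> k" for k
    using noncrossing_descent[OF S, of k] noncrossingD[OF S ij] that by force
  then show ?thesis
    using noncrossing_nested[OF S] noncrossingD[OF S] ij unfolding noncrossing_def by fastforce
qed

section \<open>Gluing and cutting adjacent blocks\<close>

text \<open>No hook of the union starts at \<open>m\<close>: it is the last position of the left
  block and lies outside the right one. Hence \<open>m\<close> must not be a descent.\<close>

lemma noncrossing_Un:
  assumes S1: "noncrossing \<pi> l m S1" and S2: "noncrossing \<pi> (Suc m) r S2" and "l \<le> m" "m < r"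
    and "\<pi> m \<le> \<pi> (Suc m)"
  shows "noncrossing \<pi> l r (S1 \<union> S2)"
proof -
  note D = noncrossingD[OF S1] noncrossingD[OF S2]
  have range: "l \<le> i \<and> i < j \<and> j \<le> r \<and> \<pi> i < \<pi> j" if "(i, j) \<in> S1 \<union> S2" for i j
    using that D[of i j] assms(3,4) by auto
  have nested: "j' \<le> j" if "(i, j) \<in> S1 \<union> S2" "(i', j') \<in> S1 \<union> S2" "i \<le> i'" "i' < j" for i j i' j'
  proof -
    consider "(i, j) \<in> S1" "(i', j') \<in> S1" | "(i, j) \<in> S1" "(i', j') \<in> S2"
      | "(i, j) \<in> S2" "(i', j') \<in> S1" | "(i, j) \<in> S2" "(i', j') \<in> S2"
      using \<open>(i, j) \<in> S1 \<union> S2\<close> \<open>(i', j') \<in> S1 \<union> S2\<close> by blast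
    then show ?thesis
    proof cases
      case 1
      then show ?thesis using noncrossing_nested[OF S1] that by blast
    next
      case 2
      then show ?thesis using D(3)[of i j] D(5)[of i' j'] that by simp
    next
      case 3
      then show ?thesis using D(5,6)[of i j] D(3)[of i' j'] by simp
    next
      case 4
      then show ?thesis using noncrossing_nested[OF S2] that by blast
    qed
  qed
  have descents: "\<exists>j. (i, j) \<in> S1 \<union> S2" if "l \<le> i" "i < r" "\<pi> (Suc i) < \<pi> i" for i
  proof -
    have "i < m \<or> Suc m \<le> i" using that assms(5) by (metis not_less not_less_eq_eq le_antisym)
    then show ?thesis
      using noncrossing_descent[OF S1, of i] noncrossing_descent[OF S2, of i] that by auto
  qed
  show ?thesis by (rule noncrossingI[OF range nested descents])
qed

text \<open>Here \<open>m\<close> may be a descent, since the new hook starts there. The new hook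
  encloses every hook of the right block and meets those of the left block at most in position
  \<open>m\<close>.\<close>

lemma noncrossing_insert_Un:
  assumes S1: "noncrossing \<pi> l m S1" and S2: "noncrossing \<pi> (Suc m) r S2" and "l \<le> m" "m < r"
    and "\<pi> m < \<pi> r"
  shows "noncrossing \<pi> l r (insert (m, r) (S1 \<union> S2))"
proof -
  note D = noncrossingD[OF S1] noncrossingD[OF S2]
  have range: "l \<le> i \<and> i < j \<and> j \<le> r \<and> \<pi> i < \<pi> j" if "(i, j) \<in> insert (m, r) (S1 \<union> S2)" for i j
    using that D[of i j] assms(3-) by auto
  have nested: "j' \<le> j" if "(i, j) \<in> insert (m, r) (S1 \<union> S2)"
    "(i', j') \<in> insert (m, r) (S1 \<union> S2)" "i \<le> i'" "i' < j" for i j i' j'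
  proof -
    consider "(i, j) \<in> S1" "(i', j') \<in> S1" | "(i, j) \<in> S1" "(i', j') = (m, r) \<or> (i', j') \<in> S2"
      | "(i, j) \<in> S2" "(i', j') \<in> S1" | "(i, j) \<in> S2" "(i', j') \<in> S2"
      | "(i, j) \<in> S2" "(i', j') = (m, r)"
      | "(i, j) = (m, r)"
      using \<open>(i, j) \<in> insert (m, r) (S1 \<union> S2)\<close> \<open>(i', j') \<in> insert (m, r) (S1 \<union> S2)\<close> by blast
    then show ?thesis
    proof cases
      case 1
      then show ?thesis using noncrossing_nested[OF S1] that by blast
    next
      case 2
      then have "j \<le> m" "m \<le> i'" using D(3)[of i j] D(5)[of i' j'] by auto
      then show ?thesis using \<open>i' < j\<close> by simp
    next
      case 3
      then show ?thesis using D(5,6)[of i j] D(3)[of i' j'] by simp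
    next
      case 4
      then show ?thesis using noncrossing_nested[OF S2] that by blast
    next
      case 5
      then show ?thesis using D(5)[of i j] that by simp
    next
      case 6
      then show ?thesis using that(2) D(3,7)[of i' j'] \<open>m < r\<close> by auto
    qed
  qed
  have descents: "\<exists>j. (i, j) \<in> insert (m, r) (S1 \<union> S2)" if "l \<le> i" "i < r" "\<pi> (Suc i) < \<pi> i" for i
  proof -
    consider "i < m" | "i = m" | "Suc m \<le> i" by linarith
    then show ?thesis
      using noncrossing_descent[OF S1, of i] noncrossing_descent[OF S2, of i] that
      by cases auto
  qed
  show ?thesis by (rule noncrossingI[OF range nested descents])
qed

text \<open>The cut condition leaves hooks starting at \<open>m\<close> unrestricted, so the lemma
  serves both the cut at a hook from \<open>m\<close> to \<open>r\<close> and the cut without any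
  hook across it.\<close>

lemma noncrossing_parts:
  assumes S: "noncrossing \<pi> l r S" and "l \<le> m" "m < r"
    and cut: "\<And>i j. (i, j) \<in> S \<Longrightarrow> i < m \<Longrightarrow> j \<le> m"
  shows "noncrossing \<pi> l m (left_part m S)" "noncrossing \<pi> (Suc m) r (right_part m S)"
proof -
  have "\<exists>j. (i, j) \<in> left_part m S" if "l \<le> i" "i < m" "\<pi> (Suc i) < \<pi> i" for i
    using noncrossing_descent[OF S, of i] cut[of i] that \<open>m < r\<close>
    unfolding left_part_def by fastforce
  then show "noncrossing \<pi> l m (left_part m S)"
    using noncrossing_nested[OF S] noncrossingD[OF S]
    unfolding noncrossing_def left_part_def by fastforce
  have "\<exists>j. (i, j) \<in> right_part m S" if "Suc m \<le> i" "i < r" "\<pi> (Suc i) < \<pi> i" for i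
    using noncrossing_descent[OF S, of i] that \<open>l \<le> m\<close>
    unfolding right_part_def by fastforce
  then show "noncrossing \<pi> (Suc m) r (right_part m S)"
    using noncrossing_nested[OF S] noncrossingD[OF S]
    unfolding noncrossing_def right_part_def by fastforce
qed

section \<open>Colour classes and weights under gluing\<close>

lemma uncovered_cong:
  assumes "\<And>i j. l \<le> i \<Longrightarrow> i < r \<Longrightarrow> (i, j) \<in> S \<longleftrightarrow> (i, j) \<in> S'"
  shows "uncovered S l r = uncovered S' l r"
  using assms unfolding uncovered_def by fastforce

text \<open>The class of a hook depends only on hooks starting under it, and these lie in the same
  block as the hook itself. So no factor changes.\<close>

lemma hook_weight_Un:
  assumes S1: "noncrossing \<pi> l m S1" and S2: "noncrossing \<pi> (Suc m) r S2"
  shows "hook_weight (S1 \<union> S2) = hook_weight S1 * hook_weight S2"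
proof -
  note D = noncrossingD[OF S1] noncrossingD[OF S2]
  have "S1 \<inter> S2 = {}" using D by fastforce
  then have "hook_weight (S1 \<union> S2) =
      (\<Prod>h\<in>S1. catalan (card (uncovered (S1 \<union> S2) (Suc (sw h)) (ne h)) - 1)) *
      (\<Prod>h\<in>S2. catalan (card (uncovered (S1 \<union> S2) (Suc (sw h)) (ne h)) - 1))"
    unfolding hook_weight_def
    by (intro prod.union_disjoint noncrossing_finite[OF S1] noncrossing_finite[OF S2])
  also have "(\<Prod>h\<in>S1. catalan (card (uncovered (S1 \<union> S2) (Suc (sw h)) (ne h)) - 1)) = hook_weight S1"
    unfolding hook_weight_def
  proof (intro prod.cong refl arg_cong[where f = "\<lambda>X. catalan (card X - 1)"] uncovered_cong)
    fix h i j assume "h \<in> S1" "i < ne h"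
    then have "i < m" using D(3)[of "sw h" "ne h"] by simp
    then show "(i, j) \<in> S1 \<union> S2 \<longleftrightarrow> (i, j) \<in> S1" using D(5)[of i j] by auto
  qed
  also have "(\<Prod>h\<in>S2. catalan (card (uncovered (S1 \<union> S2) (Suc (sw h)) (ne h)) - 1)) = hook_weight S2"
    unfolding hook_weight_def
  proof (intro prod.cong refl arg_cong[where f = "\<lambda>X. catalan (card X - 1)"] uncovered_cong)
    fix h i j assume "h \<in> S2" "Suc (sw h) \<le> i"
    then have "m < i" using D(5)[of "sw h" "ne h"] by simp
    then show "(i, j) \<in> S1 \<union> S2 \<longleftrightarrow> (i, j) \<in> S2" using D(2,3)[of i j] by auto
  qed
  finally show ?thesis .
qed

text \<open>The new hook covers the whole right block: its class is what was class 0 of that block,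
  and class 0 of the large block is class 0 of the left one. Thus the two factors for colour 0 on
  the right-hand side become one factor for the hook and one for colour 0.\<close>

lemma weight_insert_Un:
  assumes S1: "noncrossing \<pi> l m S1" and S2: "noncrossing \<pi> (Suc m) r S2" and "l \<le> m" "m < r"
  shows "weight l r (insert (m, r) (S1 \<union> S2)) = weight l m S1 * weight (Suc m) r S2"
proof -
  note D = noncrossingD[OF S1] noncrossingD[OF S2]
  let ?S = "insert (m, r) (S1 \<union> S2)"
  have "(m, r) \<notin> S1 \<union> S2" using D(3,5)[of m r] \<open>m < r\<close> by auto
  then have "hook_weight ?S = catalan (card (uncovered ?S (Suc m) r) - 1) *
      (\<Prod>h\<in>S1 \<union> S2. catalan (card (uncovered ?S (Suc (sw h)) (ne h)) - 1))"
    unfolding hook_weight_def using noncrossing_finite[OF S1] noncrossing_finite[OF S2] by simp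
  also have "uncovered ?S (Suc m) r = uncovered S2 (Suc m) r"
    using D(2,3) by (intro uncovered_cong) fastforce
  also have "(\<Prod>h\<in>S1 \<union> S2. catalan (card (uncovered ?S (Suc (sw h)) (ne h)) - 1)) =
      hook_weight (S1 \<union> S2)"
    unfolding hook_weight_def
  proof (intro prod.cong refl arg_cong[where f = "\<lambda>X. catalan (card X - 1)"] uncovered_cong)
    fix h i j assume "h \<in> S1 \<union> S2" "Suc (sw h) \<le> i" "i < ne h"
    then have "i \<noteq> m" using D(3,5)[of "sw h" "ne h"] by auto
    then show "(i, j) \<in> ?S \<longleftrightarrow> (i, j) \<in> S1 \<union> S2" by auto
  qed
  also have "\<dots> = hook_weight S1 * hook_weight S2" by (rule hook_weight_Un[OF S1 S2])
  finally have "hook_weight ?S =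
      catalan (card (uncovered S2 (Suc m) r) - 1) * (hook_weight S1 * hook_weight S2)" .
  moreover have "uncovered ?S l r = uncovered S1 l m"
  proof (intro set_eqI iffI)
    fix k assume "k \<in> uncovered ?S l r"
    then show "k \<in> uncovered S1 l m"
      using \<open>l \<le> m\<close> unfolding uncovered_def by force
  next
    fix k assume k: "k \<in> uncovered S1 l m"
    then have "j < k" if "(i, j) \<in> ?S" "l \<le> i" "i < k" for i j
      using that D(5)[of i j] unfolding uncovered_def by auto
    then show "k \<in> uncovered ?S l r" using k \<open>m < r\<close> unfolding uncovered_def by auto
  qed
  ultimately show ?thesis unfolding weight_def by (simp only: mult_ac)
qed

text \<open>Without a hook across the cut, class 0 of the large block consists of the two classes 0
  side by side. The form below gives the sizes needed for the Catalan convolution.\<close>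

lemma uncovered_Un:
  assumes S1: "noncrossing \<pi> l m S1" and S2: "noncrossing \<pi> (Suc m) r S2" and "l \<le> m" "m < r"
  shows "{k \<in> uncovered (S1 \<union> S2) l r. k \<le> m} = uncovered S1 l m"
    and "{k \<in> uncovered (S1 \<union> S2) l r. Suc m \<le> k} = uncovered S2 (Suc m) r"
proof -
  note D = noncrossingD[OF S1] noncrossingD[OF S2]
  show "{k \<in> uncovered (S1 \<union> S2) l r. k \<le> m} = uncovered S1 l m"
    using \<open>m < r\<close> D(5) unfolding uncovered_def by fastforce
  show "{k \<in> uncovered (S1 \<union> S2) l r. Suc m \<le> k} = uncovered S2 (Suc m) r"
  proof (intro set_eqI iffI)
    fix k assume k: "k \<in> uncovered S2 (Suc m) r"
    have "j < k" if "(i, j) \<in> S1 \<union> S2" "l \<le> i" "i < k" for i j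
      using that D(3,5)[of i j] k unfolding uncovered_def by auto
    then show "k \<in> {k \<in> uncovered (S1 \<union> S2) l r. Suc m \<le> k}"
      using k \<open>l \<le> m\<close> unfolding uncovered_def by auto
  qed (use \<open>l \<le> m\<close> in \<open>auto simp: uncovered_def\<close>)
qed

lemma parts_Un:
  assumes S1: "noncrossing \<pi> l m S1" and S2: "noncrossing \<pi> (Suc m) r S2"
  shows "left_part m (S1 \<union> S2) = S1" "right_part m (S1 \<union> S2) = S2"
  using noncrossingD[OF S1] noncrossingD[OF S2]
  unfolding left_part_def right_part_def by fastforce+

lemma parts_insert:
  assumes "m < r"
  shows "left_part m (insert (m, r) S) = left_part m S"
    and "right_part m (insert (m, r) S) = right_part m S"
  using assms by (auto simp: left_part_def right_part_def)

section \<open>Recursions for the weighted counts\<close>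

lemma sum_pairs_rec:
  fixes f g :: "nat \<Rightarrow> hook set \<Rightarrow> nat"
  assumes "finite M" "\<And>m. finite (X m)" "\<And>m. finite (Y m)"
  shows "(\<Sum>(m, S1, S2)\<in>(SIGMA m:M. X m \<times> Y m). f m S1 * g m S2) =
    (\<Sum>m\<in>M. (\<Sum>S1\<in>X m. f m S1) * (\<Sum>S2\<in>Y m. g m S2))"
proof -
  have "(\<Sum>(m, p)\<in>(SIGMA m:M. X m \<times> Y m). f m (fst p) * g m (snd p)) =
      (\<Sum>m\<in>M. \<Sum>p\<in>X m \<times> Y m. f m (fst p) * g m (snd p))"
    using assms by (intro sum.Sigma[symmetric]) auto
  also have "\<dots> = (\<Sum>m\<in>M. \<Sum>S1\<in>X m. \<Sum>S2\<in>Y m. f m S1 * g m S2)"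
    by (simp add: sum.cartesian_product case_prod_unfold)
  finally show ?thesis by (simp add: sum_product case_prod_unfold)
qed

section \<open>Cutting at the leftmost hook that ends in the last position\<close>

text \<open>The left part keeps every hook ending in \<open>j\<close>. The right part could lose the
  one starting at a descent, so there all hooks ending in \<open>j\<close> are required to start
  after \<open>m\<close>.\<close>

lemma closed_at_parts:
  assumes S: "noncrossing \<pi> l r S" and ij: "(i, j) \<in> S" and "closed_at \<pi> S j"
  shows "j \<le> m \<Longrightarrow> closed_at \<pi> (left_part m S) j"
    and "m < i \<Longrightarrow> (\<And>i'. (i', j) \<in> S \<Longrightarrow> m < i') \<Longrightarrow> closed_at \<pi> (right_part m S) j"
  using assms(3) noncrossingD(2)[OF S ij]
  unfolding closed_at_def left_part_def right_part_def by auto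

lemma closed_at_mono: "closed_at \<pi> S j \<Longrightarrow> S \<subseteq> S' \<Longrightarrow> closed_at \<pi> S' j"
  unfolding closed_at_def by blast

lemma rooted_hook_setsI:
  assumes "l \<le> m" "m < r" "\<pi> m < \<pi> r" "P m"
    and S1: "S1 \<in> hook_sets \<pi> l m" and S2: "S2 \<in> rooted_hook_sets \<pi> P (Suc m) r"
  shows "insert (m, r) (S1 \<union> S2) \<in> rooted_hook_sets \<pi> P l r"
proof -
  let ?S = "insert (m, r) (S1 \<union> S2)"
  have N1: "noncrossing \<pi> l m S1" and N2: "noncrossing \<pi> (Suc m) r S2"
    using S1 S2 by (auto simp: hook_sets_def rooted_hook_sets_def)
  note D = noncrossingD[OF N1] noncrossingD[OF N2]
  have "noncrossing \<pi> l r ?S" by (rule noncrossing_insert_Un[OF N1 N2 assms(1-3)])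
  moreover have "closed_at \<pi> ?S j" if "(i, j) \<in> ?S" "j < r" for i j
  proof -
    have "closed_at \<pi> S1 j \<or> closed_at \<pi> S2 j"
      using that S1 S2 by (auto simp: hook_sets_def rooted_hook_sets_def)
    then show ?thesis by (auto intro: closed_at_mono)
  qed
  \<comment> \<open>If the right block is the single position \<open>r\<close>, this hook is the new
    one; otherwise the right block contains it.\<close>
  moreover have "(r - 1, r) \<in> ?S"
    using S2 \<open>m < r\<close> by (cases "r = Suc m") (auto simp: rooted_hook_sets_def)
  moreover have "P i" if "(i, r) \<in> ?S" for i
    using that S2 D(3)[of i r] assms(2,4) by (auto simp: rooted_hook_sets_def)
  ultimately show ?thesis unfolding rooted_hook_sets_def by blast
qed

text \<open>A hook starting before \<open>m\<close> and reaching beyond it would, by nesting, have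
  to end in \<open>r\<close>, contradicting the choice of \<open>m\<close>. So removing the hook at
  \<open>m\<close> separates the block.\<close>

lemma rooted_hook_sets_first_child:
  assumes "l < r" and S: "S \<in> rooted_hook_sets \<pi> P l r"
  defines "m \<equiv> LEAST m. (m, r) \<in> S"
  shows "l \<le> m" "m < r" "\<pi> m < \<pi> r" "P m" "left_part m S \<in> hook_sets \<pi> l m"
    "right_part m S \<in> rooted_hook_sets \<pi> P (Suc m) r"
    "S = insert (m, r) (left_part m S \<union> right_part m S)"
proof -
  have N: "noncrossing \<pi> l r S" and cl: "\<And>i j. (i, j) \<in> S \<Longrightarrow> j < r \<Longrightarrow> closed_at \<pi> S j"
    and last: "(r - 1, r) \<in> S" and P: "\<And>i. (i, r) \<in> S \<Longrightarrow> P i"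
    using S \<open>l < r\<close> unfolding rooted_hook_sets_def by blast+
  have mr: "(m, r) \<in> S" unfolding m_def by (rule LeastI[of "\<lambda>m. (m, r) \<in> S", OF last])
  have least: "m \<le> i" if "(i, r) \<in> S" for i
    unfolding m_def by (rule Least_le[of "\<lambda>m. (m, r) \<in> S", OF that])
  note D = noncrossingD[OF N]
  show m: "l \<le> m" "m < r" "\<pi> m < \<pi> r" "P m" using D[OF mr] P[OF mr] by auto
  have cut: "j \<le> m" if "(i, j) \<in> S" "i < m" for i j
  proof (rule ccontr)
    assume "\<not> j \<le> m"
    then have "r \<le> j" using noncrossing_nested[OF N that(1) mr] that(2) by simp
    then have "j = r" using D(3)[OF that(1)] by simp
    then show False using least[of i] that by simp
  qed
  have only: "j = r" if "(m, j) \<in> S" for j using noncrossing_fun[OF N that mr] .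
  note parts = noncrossing_parts[OF N m(1,2) cut]
  show "left_part m S \<in> hook_sets \<pi> l m"
    using parts(1) closed_at_parts(1)[OF N] cl m(2)
    unfolding hook_sets_def by (auto simp: left_part_def)
  have "closed_at \<pi> (right_part m S) j" if "(i, j) \<in> right_part m S" "j < r" for i j
  proof (rule closed_at_parts(2)[OF N])
    show "(i, j) \<in> S" "m < i" using that by (auto simp: right_part_def)
    then show "closed_at \<pi> S j" using cl that(2) by blast
    \<comment> \<open>A hook from before \<open>m\<close> ends by \<open>m\<close>, and the one from
      \<open>m\<close> ends in \<open>r\<close>; neither can end in \<open>j\<close>, which lies
      strictly between.\<close>
    fix i' assume "(i', j) \<in> S"
    then show "m < i'" using cut[of i' j] only[of j] D(2)[OF \<open>(i, j) \<in> S\<close>] \<open>m < i\<close> \<open>j < r\<close>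
      by (metis less_imp_neq linorder_neqE_nat not_less order.strict_trans)
  qed
  moreover have "(r - 1, r) \<in> right_part m S" if "Suc m < r"
    using last that by (simp add: right_part_def)
  ultimately show "right_part m S \<in> rooted_hook_sets \<pi> P (Suc m) r"
    using parts(2) P unfolding rooted_hook_sets_def by (auto simp: right_part_def)
  have "h \<in> insert (m, r) (left_part m S \<union> right_part m S)" if "h \<in> S" for h
  proof (cases "sw h = m")
    case True
    then show ?thesis using only[of "ne h"] that by (cases h) auto
  next
    case False
    then have "sw h < m \<or> m < sw h" by linarith
    then show ?thesis
      using cut[of "sw h" "ne h"] that by (auto simp: left_part_def right_part_def)
  qed
  then show "S = insert (m, r) (left_part m S \<union> right_part m S)"
    using mr by (auto simp: left_part_def right_part_def)
qed

lemma Least_first_child: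
  assumes "noncrossing \<pi> l m S1" "noncrossing \<pi> (Suc m) r S2" "m < r"
  shows "(LEAST i. (i, r) \<in> insert (m, r) (S1 \<union> S2)) = m"
proof (rule Least_equality)
  fix i assume "(i, r) \<in> insert (m, r) (S1 \<union> S2)"
  then show "m \<le> i"
    using noncrossingD(3)[OF assms(1), of i r] noncrossingD(1)[OF assms(2), of i r] \<open>m < r\<close> by auto
qed simp

text \<open>Used for two predicates: with \<open>P\<close> always true this is the recursion of the
  trees, and with \<open>P\<close> excluding descents it is to be matched with
  \<open>sum_open_hook_sets_rec\<close>.\<close>

lemma sum_rooted_hook_sets_rec:
  assumes "l < r"
  shows "(\<Sum>S\<in>rooted_hook_sets \<pi> P l r. weight l r S) =
    (\<Sum>m\<in>{m\<in>{l..<r}. \<pi> m < \<pi> r \<and> P m}. (\<Sum>S\<in>hook_sets \<pi> l m. weight l m S) *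
      (\<Sum>S\<in>rooted_hook_sets \<pi> P (Suc m) r. weight (Suc m) r S))"
proof -
  let ?M = "{m\<in>{l..<r}. \<pi> m < \<pi> r \<and> P m}"
  let ?X = "SIGMA m:?M. hook_sets \<pi> l m \<times> rooted_hook_sets \<pi> P (Suc m) r"
  define split where "split S = (let m = LEAST m. (m, r) \<in> S in (m, left_part m S, right_part m S))"
    for S :: "hook set"
  define join :: "nat \<times> hook set \<times> hook set \<Rightarrow> hook set"
    where "join = (\<lambda>(m, S1, S2). insert (m, r) (S1 \<union> S2))"
  have "(\<Sum>S\<in>rooted_hook_sets \<pi> P l r. weight l r S) =
      (\<Sum>(m, S1, S2)\<in>?X. weight l m S1 * weight (Suc m) r S2)"
  proof (rule sum.reindex_bij_witness[of _ join split])
    fix S assume S: "S \<in> rooted_hook_sets \<pi> P l r"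
    note first = rooted_hook_sets_first_child[OF assms S]
    show "join (split S) = S" using first(7) by (simp add: join_def split_def Let_def)
    show "split S \<in> ?X" using first by (simp add: split_def Let_def)
    define m where "m = (LEAST m. (m, r) \<in> S)"
    note first' = first[folded m_def]
    have "weight l r (insert (m, r) (left_part m S \<union> right_part m S)) =
        weight l m (left_part m S) * weight (Suc m) r (right_part m S)"
      using first'(5,6) by (intro weight_insert_Un[of \<pi>] first'(1,2))
        (auto simp: hook_sets_def rooted_hook_sets_def)
    then show "(case split S of (m, S1, S2) \<Rightarrow> weight l m S1 * weight (Suc m) r S2) = weight l r S"
      using first'(7) by (simp add: split_def Let_def flip: m_def)
  next
    fix x assume x: "x \<in> ?X"
    obtain m S1 S2 where [simp]: "x = (m, S1, S2)" by (cases x)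
    have m: "l \<le> m" "m < r" "\<pi> m < \<pi> r" "P m"
      and S12: "S1 \<in> hook_sets \<pi> l m" "S2 \<in> rooted_hook_sets \<pi> P (Suc m) r"
      using x by auto
    show "join x \<in> rooted_hook_sets \<pi> P l r"
      using rooted_hook_setsI[OF m S12] by (simp add: join_def)
    have N: "noncrossing \<pi> l m S1" "noncrossing \<pi> (Suc m) r S2"
      using S12 by (auto simp: hook_sets_def rooted_hook_sets_def)
    show "split (join x) = x"
      using Least_first_child[OF N m(2)] parts_Un[OF N] parts_insert[OF m(2)]
      by (simp add: join_def split_def Let_def)
  qed
  then show ?thesis by (simp add: sum_pairs_rec)
qed

section \<open>Cutting along the class of colour 0\<close>

lemma open_hook_setsI:
  assumes "l \<le> m" "m < r" "\<pi> m \<le> \<pi> (Suc m)"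
    and S1: "S1 \<in> hook_sets \<pi> l m" and S2: "S2 \<in> open_hook_sets \<pi> (Suc m) r"
  shows "S1 \<union> S2 \<in> open_hook_sets \<pi> l r" "Suc m \<in> uncovered (S1 \<union> S2) l r"
proof -
  have N1: "noncrossing \<pi> l m S1" and N2: "noncrossing \<pi> (Suc m) r S2"
    using S1 S2 by (auto simp: hook_sets_def open_hook_sets_def)
  note D = noncrossingD[OF N1] noncrossingD[OF N2]
  have "noncrossing \<pi> l r (S1 \<union> S2)" by (rule noncrossing_Un[OF N1 N2 assms(1-3)])
  moreover have "closed_at \<pi> (S1 \<union> S2) j" if "(i, j) \<in> S1 \<union> S2" for i j
  proof -
    have "closed_at \<pi> S1 j \<or> closed_at \<pi> S2 j"
      using that S1 S2 by (auto simp: hook_sets_def open_hook_sets_def)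
    then show ?thesis by (auto intro: closed_at_mono)
  qed
  moreover have "(i, r) \<notin> S1 \<union> S2" for i
    using S2 D(3)[of i r] \<open>m < r\<close> by (auto simp: open_hook_sets_def)
  ultimately show "S1 \<union> S2 \<in> open_hook_sets \<pi> l r"
    unfolding open_hook_sets_def hook_sets_def by blast
  have "j < Suc m" if "(i, j) \<in> S1 \<union> S2" "i < Suc m" for i j
    using that D(3,5)[of i j] by auto
  then show "Suc m \<in> uncovered (S1 \<union> S2) l r"
    using assms(1,2) by (auto simp: uncovered_def)
qed

text \<open>That \<open>Suc m\<close> is uncovered means that every hook starting at or before
  \<open>m\<close> ends by \<open>m\<close>. In particular none starts at \<open>m\<close>, so
  \<open>m\<close> is not a descent.\<close>

lemma open_hook_sets_cut:
  assumes "inj \<pi>" and S: "S \<in> open_hook_sets \<pi> l r" and "l \<le> m" "m < r"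
    and unc: "Suc m \<in> uncovered S l r"
  shows "\<pi> m \<le> \<pi> (Suc m)" "left_part m S \<in> hook_sets \<pi> l m"
    "right_part m S \<in> open_hook_sets \<pi> (Suc m) r" "S = left_part m S \<union> right_part m S"
proof -
  have N: "noncrossing \<pi> l r S" and cl: "\<And>i j. (i, j) \<in> S \<Longrightarrow> closed_at \<pi> S j"
    and op: "\<And>i. (i, r) \<notin> S"
    using S unfolding open_hook_sets_def hook_sets_def by blast+
  note D = noncrossingD[OF N]
  have cut': "j \<le> m" if "(i, j) \<in> S" "i \<le> m" for i j
  proof -
    have "j < Suc m"
      using unc that(1) D(1)[OF that(1)] le_imp_less_Suc[OF that(2)] unfolding uncovered_def by blast
    then show ?thesis by simp
  qed
  have cut: "j \<le> m" if "(i, j) \<in> S" "i < m" for i j using cut'[OF that(1)] that(2) by simp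
  show "\<pi> m \<le> \<pi> (Suc m)"
  proof (rule ccontr)
    assume "\<not> \<pi> m \<le> \<pi> (Suc m)"
    then obtain j where j: "(m, j) \<in> S" using noncrossing_descent[OF N assms(3,4)] by auto
    show False using cut'[OF j] D(2)[OF j] by simp
  qed
  note parts = noncrossing_parts[OF N assms(3,4) cut]
  show "left_part m S \<in> hook_sets \<pi> l m"
    using parts(1) closed_at_parts(1)[OF N] cl
    unfolding hook_sets_def by (auto simp: left_part_def)
  have "closed_at \<pi> (right_part m S) j" if "(i, j) \<in> right_part m S" for i j
  proof (rule closed_at_parts(2)[OF N])
    show "(i, j) \<in> S" "m < i" using that by (auto simp: right_part_def)
    then show "closed_at \<pi> S j" using cl by blast
    fix i' assume "(i', j) \<in> S"
    then show "m < i'" using cut'[of i' j] D(2)[OF \<open>(i, j) \<in> S\<close>] \<open>m < i\<close> by fastforce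
  qed
  then show "right_part m S \<in> open_hook_sets \<pi> (Suc m) r"
    using parts(2) op unfolding open_hook_sets_def hook_sets_def by (auto simp: right_part_def)
  have "h \<in> left_part m S \<union> right_part m S" if "h \<in> S" for h
    using cut'[of "sw h" "ne h"] that by (cases h) (auto simp: left_part_def right_part_def)
  then show "S = left_part m S \<union> right_part m S"
    by (auto simp: left_part_def right_part_def)
qed

text \<open>Ranks increase strictly along \<open>X\<close>, which gives injectivity; comparing
  cardinalities gives surjectivity.\<close>

lemma bij_betw_card_less:
  fixes X :: "nat set"
  assumes "finite X"
  shows "bij_betw (\<lambda>x. card {y\<in>X. y < x}) X {..<card X}"
proof -
  have less: "card {y\<in>X. y < x} < card {y\<in>X. y < x'}" if "x \<in> X" "x < x'" for x x'
    using that assms by (intro psubset_card_mono) auto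
  have inj: "inj_on (\<lambda>x. card {y\<in>X. y < x}) X"
  proof (rule inj_onI, rule ccontr)
    fix x x' assume "x \<in> X" "x' \<in> X" "card {y\<in>X. y < x} = card {y\<in>X. y < x'}" "x \<noteq> x'"
    then show False using less[of x x'] less[of x' x] by (cases "x < x'") auto
  qed
  moreover have "(\<lambda>x. card {y\<in>X. y < x}) ` X = {..<card X}"
  proof (rule card_subset_eq)
    show "(\<lambda>x. card {y\<in>X. y < x}) ` X \<subseteq> {..<card X}"
      using assms by (auto intro!: psubset_card_mono)
  qed (simp_all add: card_image[OF inj])
  ultimately show ?thesis by (simp add: bij_betw_def)
qed

text \<open>The Catalan recurrence as a sum over the ways to cut \<open>X\<close> into a nonempty
  lower and a nonempty upper part. A cut is recorded by the least element \<open>x\<close> of the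
  upper part, so the least element \<open>l\<close> of \<open>X\<close> is excluded.\<close>

lemma catalan_card_cut:
  fixes X :: "nat set"
  assumes "finite X" "l \<in> X" "\<And>x. x \<in> X \<Longrightarrow> l \<le> x" "card X \<ge> 2"
  shows "catalan (card X - 1) =
    (\<Sum>x\<in>X - {l}. catalan (card {y\<in>X. y < x} - 1) * catalan (card {y\<in>X. x \<le> y} - 1))"
proof -
  define c where "c = (\<lambda>x. card {y\<in>X. y < x})"
  obtain n where n: "card X = n + 2" using assms(4) le_Suc_ex by (metis add.commute)
  have "{y\<in>X. y < l} = {}" using assms(3) by force
  then have "c l = 0" by (simp add: c_def)
  have bij: "bij_betw c X {..<card X}"
    using bij_betw_card_less[OF assms(1)] by (simp add: c_def)
  have "bij_betw c (X - {l}) ({..<card X} - {0})"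
    using bij_betw_DiffI[OF bij, of "{l}" "{0}"] assms(2) \<open>c l = 0\<close> by (simp add: bij_betw_def n)
  \<comment> \<open>The lower part has between 1 and \<open>n + 1\<close> elements; the shift by one
    turns its size into the summation index of \<open>catalan_Suc\<close>.\<close>
  moreover have "{..<card X} - {0} = Suc ` {..n}"
    unfolding image_Suc_atMost by (auto simp: n)
  ultimately have bij': "bij_betw c (X - {l}) (Suc ` {..n})" by simp
  have "card {y\<in>X. x \<le> y} = card X - c x" for x
  proof -
    have "{y\<in>X. x \<le> y} = X - {y\<in>X. y < x}" by auto
    then show ?thesis using assms(1) by (simp add: card_Diff_subset c_def)
  qed
  then have "(\<Sum>x\<in>X - {l}. catalan (card {y\<in>X. y < x} - 1) * catalan (card {y\<in>X. x \<le> y} - 1)) =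
      (\<Sum>x\<in>X - {l}. catalan (c x - 1) * catalan (card X - c x - 1))"
    by (simp add: c_def)
  also have "\<dots> = (\<Sum>a\<in>Suc ` {..n}. catalan (a - 1) * catalan (card X - a - 1))"
    by (rule sum.reindex_bij_betw[OF bij'])
  also have "\<dots> = (\<Sum>i\<le>n. catalan i * catalan (n - i))"
    by (simp add: sum.reindex n)
  finally show ?thesis by (simp add: n catalan_Suc)
qed

text \<open>As \<open>r\<close> is not a northeast endpoint, both \<open>l\<close> and
  \<open>r\<close> have colour 0, so class 0 has at least two elements and
  \<open>catalan_card_cut\<close> applies to it. Each cut falls just before an uncovered position
  and splits the factors of the hooks as well.\<close>

lemma weight_cut:
  assumes "inj \<pi>" "l < r" and S: "S \<in> open_hook_sets \<pi> l r"
  shows "weight l r S = (\<Sum>m\<in>{m\<in>{l..<r}. Suc m \<in> uncovered S l r}.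
    weight l m (left_part m S) * weight (Suc m) r (right_part m S))"
proof -
  let ?X = "uncovered S l r" and ?M = "{m\<in>{l..<r}. Suc m \<in> uncovered S l r}"
  have N: "noncrossing \<pi> l r S" and op: "\<And>i. (i, r) \<notin> S"
    using S unfolding open_hook_sets_def hook_sets_def by blast+
  have X: "finite ?X" "l \<in> ?X" "\<And>x. x \<in> ?X \<Longrightarrow> l \<le> x"
    using \<open>l < r\<close> by (auto simp: uncovered_def)
  have "r \<in> ?X"
    using \<open>l < r\<close> op noncrossingD(3)[OF N] by (force simp: uncovered_def le_less)
  then have "card {l, r} \<le> card ?X" using X by (intro card_mono) auto
  then have "card ?X \<ge> 2" using \<open>l < r\<close> by simp
  have "?X - {l} = Suc ` ?M"
  proof (intro set_eqI iffI)
    fix x assume x: "x \<in> ?X - {l}"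
    then have "l < x" "x \<le> r" by (auto simp: uncovered_def)
    then show "x \<in> Suc ` ?M" using x by (intro image_eqI[of _ _ "x - 1"]) auto
  qed (auto simp: uncovered_def)
  then have "catalan (card ?X - 1) = (\<Sum>m\<in>?M. catalan (card {y\<in>?X. y < Suc m} - 1) *
      catalan (card {y\<in>?X. Suc m \<le> y} - 1))"
    using catalan_card_cut[OF X \<open>card ?X \<ge> 2\<close>] by (simp add: sum.reindex)
  then have "weight l r S = (\<Sum>m\<in>?M. catalan (card {y\<in>?X. y < Suc m} - 1) *
      catalan (card {y\<in>?X. Suc m \<le> y} - 1) * hook_weight S)"
    by (simp only: weight_def sum_distrib_right)
  also have "\<dots> = (\<Sum>m\<in>?M. weight l m (left_part m S) * weight (Suc m) r (right_part m S))"
  proof (rule sum.cong[OF refl])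
    fix m assume "m \<in> ?M"
    then have m: "l \<le> m" "m < r" "Suc m \<in> ?X" by auto
    note cut = open_hook_sets_cut[OF assms(1) S m]
    have N12: "noncrossing \<pi> l m (left_part m S)" "noncrossing \<pi> (Suc m) r (right_part m S)"
      using cut(2,3) by (auto simp: hook_sets_def open_hook_sets_def)
    have "hook_weight S = hook_weight (left_part m S) * hook_weight (right_part m S)"
      using hook_weight_Un[OF N12] cut(4) by simp
    moreover have "{y\<in>?X. y < Suc m} = uncovered (left_part m S) l m"
      "{y\<in>?X. Suc m \<le> y} = uncovered (right_part m S) (Suc m) r"
      using uncovered_Un[OF N12 m(1,2)] by (simp_all add: less_Suc_eq_le flip: cut(4))
    ultimately show "catalan (card {y\<in>?X. y < Suc m} - 1) *
        catalan (card {y\<in>?X. Suc m \<le> y} - 1) * hook_weight S =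
        weight l m (left_part m S) * weight (Suc m) r (right_part m S)"
      unfolding weight_def by (simp only: mult_ac)
  qed
  finally show ?thesis .
qed

text \<open>Double counting: \<open>weight_cut\<close> distributes the weight of a configuration
  over its cuts, and a configuration with a chosen cut is the same as a pair of configurations on
  adjacent blocks.\<close>

lemma sum_open_hook_sets_rec:
  assumes "inj \<pi>" "l < r"
  shows "(\<Sum>S\<in>open_hook_sets \<pi> l r. weight l r S) =
    (\<Sum>m\<in>{m\<in>{l..<r}. \<pi> m \<le> \<pi> (Suc m)}. (\<Sum>S\<in>hook_sets \<pi> l m. weight l m S) *
      (\<Sum>S\<in>open_hook_sets \<pi> (Suc m) r. weight (Suc m) r S))"
proof -
  let ?M = "{m\<in>{l..<r}. \<pi> m \<le> \<pi> (Suc m)}"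
  let ?C = "\<lambda>S. {m\<in>{l..<r}. Suc m \<in> uncovered S l r}"
  let ?X = "SIGMA m:?M. hook_sets \<pi> l m \<times> open_hook_sets \<pi> (Suc m) r"
  have "(\<Sum>S\<in>open_hook_sets \<pi> l r. weight l r S) =
      (\<Sum>S\<in>open_hook_sets \<pi> l r. \<Sum>m\<in>?C S.
        weight l m (left_part m S) * weight (Suc m) r (right_part m S))"
    by (intro sum.cong refl weight_cut[OF assms])
  also have "\<dots> = (\<Sum>(S, m)\<in>(SIGMA S:open_hook_sets \<pi> l r. ?C S).
        weight l m (left_part m S) * weight (Suc m) r (right_part m S))"
    by (intro sum.Sigma) auto
  also have "\<dots> = (\<Sum>(m, S1, S2)\<in>?X. weight l m S1 * weight (Suc m) r S2)"
  proof (rule sum.reindex_bij_witness[of _ "\<lambda>(m, S1, S2). (S1 \<union> S2, m)"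
        "\<lambda>(S, m). (m, left_part m S, right_part m S)"])
    fix x assume "x \<in> (SIGMA S:open_hook_sets \<pi> l r. ?C S)"
    then obtain S m where [simp]: "x = (S, m)" and S: "S \<in> open_hook_sets \<pi> l r"
      and m: "l \<le> m" "m < r" "Suc m \<in> uncovered S l r" by auto
    note cut = open_hook_sets_cut[OF assms(1) S m]
    show "(case case x of (S, m) \<Rightarrow> (m, left_part m S, right_part m S) of
        (m, S1, S2) \<Rightarrow> (S1 \<union> S2, m)) = x"
      using cut(4) by simp
    show "(case x of (S, m) \<Rightarrow> (m, left_part m S, right_part m S)) \<in> ?X"
      using cut(1-3) m by simp
  next
    fix x assume "x \<in> ?X"
    then obtain m S1 S2 where [simp]: "x = (m, S1, S2)" and m: "l \<le> m" "m < r" "\<pi> m \<le> \<pi> (Suc m)"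
      and S12: "S1 \<in> hook_sets \<pi> l m" "S2 \<in> open_hook_sets \<pi> (Suc m) r" by auto
    have N: "noncrossing \<pi> l m S1" "noncrossing \<pi> (Suc m) r S2"
      using S12 by (auto simp: hook_sets_def open_hook_sets_def)
    show "(case case x of (m, S1, S2) \<Rightarrow> (S1 \<union> S2, m) of
        (S, m) \<Rightarrow> (m, left_part m S, right_part m S)) = x"
      using parts_Un[OF N] by simp
    show "(case x of (m, S1, S2) \<Rightarrow> (S1 \<union> S2, m)) \<in> (SIGMA S:open_hook_sets \<pi> l r. ?C S)"
      using open_hook_setsI[OF m S12] m by simp
  qed auto
  finally show ?thesis by (simp add: sum_pairs_rec)
qed

section \<open>Comparison of the recursions\<close>

lemma hook_sets_singleton:
  "hook_sets \<pi> r r = {{}}" "rooted_hook_sets \<pi> P r r = {{}}" "open_hook_sets \<pi> r r = {{}}"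
  unfolding hook_sets_def rooted_hook_sets_def open_hook_sets_def
  by (auto simp: noncrossing_singleton)

text \<open>The two recursions differ only in the condition \<open>\<pi> m < \<pi> r\<close>, and
  the terms violating it vanish in the recursion for \<open>open_hook_sets\<close>.\<close>

lemma sum_rooted_eq_sum_open:
  assumes "inj \<pi>" "l \<le> r"
  shows "(\<Sum>S\<in>rooted_hook_sets \<pi> (\<lambda>i. \<pi> i \<le> \<pi> (Suc i)) l r. weight l r S) =
    (\<Sum>S\<in>open_hook_sets \<pi> l r. weight l r S)"
  using \<open>l \<le> r\<close>
proof (induction "r - l" arbitrary: l rule: less_induct)
  case less
  show ?case
  proof (cases "l = r")
    case True
    then show ?thesis by (simp add: hook_sets_singleton)
  next
    case False
    then have "l < r" using less.prems by simp
    show ?thesis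
      unfolding sum_rooted_hook_sets_rec[OF \<open>l < r\<close>] sum_open_hook_sets_rec[OF assms(1) \<open>l < r\<close>]
    proof (rule sum.mono_neutral_cong_left)
      show "\<forall>m\<in>{m\<in>{l..<r}. \<pi> m \<le> \<pi> (Suc m)} - {m\<in>{l..<r}. \<pi> m < \<pi> r \<and> \<pi> m \<le> \<pi> (Suc m)}.
        (\<Sum>S\<in>hook_sets \<pi> l m. weight l m S) *
        (\<Sum>S\<in>open_hook_sets \<pi> (Suc m) r. weight (Suc m) r S) = 0"
      proof
        fix m assume "m \<in> {m\<in>{l..<r}. \<pi> m \<le> \<pi> (Suc m)} -
          {m\<in>{l..<r}. \<pi> m < \<pi> r \<and> \<pi> m \<le> \<pi> (Suc m)}"
        then have m: "m < r" "\<pi> m \<le> \<pi> (Suc m)" "\<pi> r \<le> \<pi> m" by auto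
        moreover have "\<pi> m \<noteq> \<pi> r" "\<pi> m \<noteq> \<pi> (Suc m)" using \<open>m < r\<close> inj_eq[OF assms(1)] by auto
        \<comment> \<open>The right block would begin with an entry larger than its last one, which
          \<open>noncrossing_last_max\<close> rules out; a one-element right block contradicts the
          assumptions on \<open>m\<close> directly.\<close>
        ultimately have "\<not> noncrossing \<pi> (Suc m) r S" for S
          using noncrossing_last_max[OF assms(1), of "Suc m" r S "Suc m"] by (cases "Suc m = r") auto
        then have "open_hook_sets \<pi> (Suc m) r = {}"
          by (auto simp: open_hook_sets_def hook_sets_def)
        then show "(\<Sum>S\<in>hook_sets \<pi> l m. weight l m S) *
            (\<Sum>S\<in>open_hook_sets \<pi> (Suc m) r. weight (Suc m) r S) = 0" by simp
      qed
    qed (use less.hyps in auto)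
  qed
qed

text \<open>If some hook ending in \<open>r\<close> starts at a descent, then \<open>r\<close>
  satisfies condition (c) and the configuration is valid; otherwise all these hooks start at
  non-descents.\<close>

lemma hook_sets_conv_rooted:
  assumes "l \<le> r"
  shows "rooted_hook_sets \<pi> (\<lambda>_. True) l r =
      {S \<in> hook_sets \<pi> l r. \<exists>i. (i, r) \<in> S} \<union> rooted_hook_sets \<pi> (\<lambda>i. \<pi> i \<le> \<pi> (Suc i)) l r"
    and "{S \<in> hook_sets \<pi> l r. \<exists>i. (i, r) \<in> S} \<inter>
      rooted_hook_sets \<pi> (\<lambda>i. \<pi> i \<le> \<pi> (Suc i)) l r = {}"
proof -
  show "rooted_hook_sets \<pi> (\<lambda>_. True) l r =
      {S \<in> hook_sets \<pi> l r. \<exists>i. (i, r) \<in> S} \<union> rooted_hook_sets \<pi> (\<lambda>i. \<pi> i \<le> \<pi> (Suc i)) l r"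
  proof (intro equalityI subsetI)
    fix S assume S: "S \<in> rooted_hook_sets \<pi> (\<lambda>_. True) l r"
    then have N: "noncrossing \<pi> l r S" by (simp add: rooted_hook_sets_def)
    show "S \<in> {S \<in> hook_sets \<pi> l r. \<exists>i. (i, r) \<in> S} \<union>
        rooted_hook_sets \<pi> (\<lambda>i. \<pi> i \<le> \<pi> (Suc i)) l r"
    proof (cases "\<exists>i. (i, r) \<in> S \<and> \<pi> (Suc i) < \<pi> i")
      case True
      then obtain i where i: "(i, r) \<in> S" "\<pi> (Suc i) < \<pi> i" by blast
      have "l < r" using noncrossingD(1,2)[OF N i(1)] by simp
      then have "(r - 1, r) \<in> S" using S by (simp add: rooted_hook_sets_def)
      then have "closed_at \<pi> S r" using i by (auto simp: closed_at_def)
      then have "closed_at \<pi> S j" if "(i', j) \<in> S" for i' j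
        using S noncrossingD(3)[OF N that] that by (cases "j = r") (auto simp: rooted_hook_sets_def)
      then show ?thesis using N i by (auto simp: hook_sets_def)
    next
      case False
      then show ?thesis using S by (auto simp: rooted_hook_sets_def not_less)
    qed
  next
    fix S assume "S \<in> {S \<in> hook_sets \<pi> l r. \<exists>i. (i, r) \<in> S} \<union>
      rooted_hook_sets \<pi> (\<lambda>i. \<pi> i \<le> \<pi> (Suc i)) l r"
    then show "S \<in> rooted_hook_sets \<pi> (\<lambda>_. True) l r"
      by (auto simp: rooted_hook_sets_def hook_sets_def closed_at_def)
  qed
  show "{S \<in> hook_sets \<pi> l r. \<exists>i. (i, r) \<in> S} \<inter>
      rooted_hook_sets \<pi> (\<lambda>i. \<pi> i \<le> \<pi> (Suc i)) l r = {}"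
    unfolding hook_sets_def rooted_hook_sets_def closed_at_def using not_less by blast
qed

lemma sum_rooted_eq_sum_hook_sets:
  assumes "inj \<pi>" "l \<le> r"
  shows "(\<Sum>S\<in>rooted_hook_sets \<pi> (\<lambda>_. True) l r. weight l r S) = (\<Sum>S\<in>hook_sets \<pi> l r. weight l r S)"
proof -
  let ?V = "{S \<in> hook_sets \<pi> l r. \<exists>i. (i, r) \<in> S}"
  have "(\<Sum>S\<in>?V \<union> open_hook_sets \<pi> l r. weight l r S) =
      (\<Sum>S\<in>?V. weight l r S) + (\<Sum>S\<in>open_hook_sets \<pi> l r. weight l r S)"
    by (intro sum.union_disjoint) (auto simp: open_hook_sets_def)
  also have "?V \<union> open_hook_sets \<pi> l r = hook_sets \<pi> l r"
    by (auto simp: open_hook_sets_def)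
  finally have "(\<Sum>S\<in>hook_sets \<pi> l r. weight l r S) =
      (\<Sum>S\<in>?V. weight l r S) + (\<Sum>S\<in>open_hook_sets \<pi> l r. weight l r S)" .
  also have "\<dots> = (\<Sum>S\<in>?V. weight l r S) +
      (\<Sum>S\<in>rooted_hook_sets \<pi> (\<lambda>i. \<pi> i \<le> \<pi> (Suc i)) l r. weight l r S)"
    by (simp add: sum_rooted_eq_sum_open[OF assms])
  also have "\<dots> = (\<Sum>S\<in>rooted_hook_sets \<pi> (\<lambda>_. True) l r. weight l r S)"
    unfolding hook_sets_conv_rooted(1)[OF assms(2)]
    using hook_sets_conv_rooted(2)[OF assms(2)] by (simp add: sum.union_disjoint)
  finally show ?thesis by simp
qed

lemma card_word_trees_eq_sum_weight:
  assumes "inj \<pi>" "l \<le> r"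
  shows "card (word_trees \<pi> l r) = (\<Sum>S\<in>hook_sets \<pi> l r. weight l r S)"
  using \<open>l \<le> r\<close>
proof (induction "r - l" arbitrary: l r rule: less_induct)
  case less
  show ?case
  proof (cases "l = r")
    case True
    then show ?thesis
      by (simp add: word_trees_singleton hook_sets_singleton weight_def hook_weight_def uncovered_def)
  next
    case False
    then have "l < r" using less.prems by simp
    have "card (word_trees \<pi> l r) = (\<Sum>m\<in>{m\<in>{l..<r}. \<pi> m < \<pi> r \<and> True}.
        (\<Sum>S\<in>hook_sets \<pi> l m. weight l m S) *
        (\<Sum>S\<in>rooted_hook_sets \<pi> (\<lambda>_. True) (Suc m) r. weight (Suc m) r S))"
      unfolding card_word_trees_rec[OF \<open>l < r\<close>]
      using less.hyps sum_rooted_eq_sum_hook_sets[OF assms(1)] by (intro sum.cong) auto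
    also have "\<dots> = (\<Sum>S\<in>hook_sets \<pi> l r. weight l r S)"
      using sum_rooted_hook_sets_rec[OF \<open>l < r\<close>, of \<pi> "\<lambda>_. True"]
        sum_rooted_eq_sum_hook_sets[OF assms(1) less.prems] by simp
    finally show ?thesis .
  qed
qed

section \<open>Colourings\<close>

lemma span_overlap_iff:
  assumes "i < j" "i' < j'"
  shows "(\<exists>x\<in>span (i, j) \<inter> span (i', j'). \<exists>y\<in>span (i, j) \<inter> span (i', j'). x \<noteq> y) \<longleftrightarrow>
    i < j' \<and> i' < j"
proof
  assume "\<exists>x\<in>span (i, j) \<inter> span (i', j'). \<exists>y\<in>span (i, j) \<inter> span (i', j'). x \<noteq> y"
  then obtain x y where "real i \<le> x" "x \<le> real j" "real i' \<le> x" "x \<le> real j'"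
    "real i \<le> y" "y \<le> real j" "real i' \<le> y" "y \<le> real j'" "x \<noteq> y"
    by (auto simp: span_def)
  then have "real i < real j'" "real i' < real j" by linarith+
  then show "i < j' \<and> i' < j" by simp
next
  assume "i < j' \<and> i' < j"
  then show "\<exists>x\<in>span (i, j) \<inter> span (i', j'). \<exists>y\<in>span (i, j) \<inter> span (i', j'). x \<noteq> y"
    \<comment> \<open>The two ends of the intersection serve as distinct common points.\<close>
    using assms by (intro bexI[of _ "real (max i i')"] bexI[of _ "real (min j j')"])
      (auto simp: span_def max_def min_def)
qed

lemma span_subset_iff:
  "i < j \<Longrightarrow> span (i, j) \<subseteq> span (i', j') \<longleftrightarrow> i' \<le> i \<and> j \<le> j'"
  by (auto simp: span_def)

text \<open>An instance of \<open>noncrossing_last_max\<close> below the hook. It converts nesting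
  of positions into comparison of heights.\<close>

lemma noncrossing_le_NE:
  assumes "inj \<pi>" and S: "noncrossing \<pi> l r S" and ij: "(i, j) \<in> S" and "i < k" "k \<le> j"
  shows "\<pi> k \<le> \<pi> j"
proof (cases "k = j")
  case False
  then show ?thesis
    using noncrossing_last_max[OF \<open>inj \<pi>\<close> noncrossing_below_hook[OF S ij], of k] assms by simp
qed simp

text \<open>The work lies in condition (d). Overlapping hooks with different ends have ends of
  different heights, so (d) nests the lower one in the higher one. Conversely, by
  \<open>noncrossing_le_NE\<close>, a nested hook is never the higher one.\<close>

lemma valid_hook_configs_iff:
  assumes "inj \<pi>"
  shows "H \<in> valid_hook_configs n \<pi> \<longleftrightarrow>
    sorted_wrt (<) (map sw H) \<and> set H \<in> hook_sets \<pi> 1 n"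
proof
  assume H: "H \<in> valid_hook_configs n \<pi>"
  then have hook: "\<And>h. h \<in> set H \<Longrightarrow> is_hook n \<pi> h"
    and sorted: "sorted_wrt (<) (map sw H)"
    and desc: "\<And>i. descent n \<pi> i \<Longrightarrow> \<exists>h\<in>set H. sw h = i"
    and closed: "\<And>h. h \<in> set H \<Longrightarrow> \<exists>h'\<in>set H. \<exists>h''\<in>set H.
        descent n \<pi> (sw h') \<and> Suc (sw h'') = ne h \<and> ne h' = ne h \<and> ne h'' = ne h"
    and nest: "\<And>h h'. h \<in> set H \<Longrightarrow> h' \<in> set H \<Longrightarrow> \<pi> (ne h) < \<pi> (ne h') \<Longrightarrow>
        \<exists>x\<in>span h \<inter> span h'. \<exists>y\<in>span h \<inter> span h'. x \<noteq> y \<Longrightarrow> span h \<subseteq> span h'"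
    unfolding valid_hook_configs_def by blast+
  have inj: "inj_on sw (set H)"
    using sorted strict_sorted_iff[of "map sw H"] by (simp add: distinct_map)
  have range: "1 \<le> i \<and> i < j \<and> j \<le> n \<and> \<pi> i < \<pi> j" if "(i, j) \<in> set H" for i j
    using hook[OF that] by (simp add: is_hook_def)
  have "noncrossing \<pi> 1 n (set H)"
  proof (rule noncrossingI[OF range])
    fix i j i' j' assume ij: "(i, j) \<in> set H" "(i', j') \<in> set H" "i \<le> i'" "i' < j"
    have lt: "i < j" "i' < j'" using range[OF ij(1)] range[OF ij(2)] by simp_all
    then have ov: "i < j'" "i' < j" using ij by simp_all
    consider "\<pi> j < \<pi> j'" | "\<pi> j' < \<pi> j" | "j = j'"
      using inj_eq[OF assms] by (meson linorder_neqE_nat)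
    then show "j' \<le> j"
    proof cases
      case 1
      then have "span (i, j) \<subseteq> span (i', j')"
        using nest[OF ij(1,2)] span_overlap_iff[OF lt] ov by simp
      \<comment> \<open>The hook starting first is the lower one here, so the inclusion forces equal
        starting positions, and then the hooks agree by condition (a).\<close>
      then have "i = i'" using span_subset_iff[OF lt(1)] \<open>i \<le> i'\<close> by simp
      then have "(i, j) = (i', j')" using inj_onD[OF inj _ ij(1,2)] by simp
      then show ?thesis by simp
    next
      case 2
      then have "span (i', j') \<subseteq> span (i, j)"
        using nest[OF ij(2,1)] span_overlap_iff[OF lt(2,1)] ov by simp
      then show ?thesis using span_subset_iff[OF lt(2)] by simp
    qed simp
  next
    fix i assume "1 \<le> i" "i < n" "\<pi> (Suc i) < \<pi> i"
    then obtain h where "h \<in> set H" "sw h = i" using desc[of i] by (auto simp: descent_def)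
    then show "\<exists>j. (i, j) \<in> set H" by (metis prod.collapse)
  qed auto
  moreover have "closed_at \<pi> (set H) j" if ij: "(i, j) \<in> set H" for i j
  proof -
    obtain h' h'' where h: "h' \<in> set H" "h'' \<in> set H" "descent n \<pi> (sw h')"
      "Suc (sw h'') = j" "ne h' = j" "ne h'' = j"
      using closed[OF ij] by auto
    then have "(sw h', j) \<in> set H" "(j - 1, j) \<in> set H" by (metis prod.collapse diff_Suc_1)+
    then show ?thesis using h(3) by (auto simp: closed_at_def descent_def)
  qed
  ultimately show "sorted_wrt (<) (map sw H) \<and> set H \<in> hook_sets \<pi> 1 n"
    using sorted unfolding hook_sets_def by blast
next
  assume "sorted_wrt (<) (map sw H) \<and> set H \<in> hook_sets \<pi> 1 n"
  then have sorted: "sorted_wrt (<) (map sw H)" and N: "noncrossing \<pi> 1 n (set H)"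
    and cl: "\<And>i j. (i, j) \<in> set H \<Longrightarrow> closed_at \<pi> (set H) j"
    unfolding hook_sets_def by blast+
  note D = noncrossingD[OF N]
  have "\<forall>h\<in>set H. is_hook n \<pi> h"
    using D by (force simp: is_hook_def)
  moreover have "\<exists>h\<in>set H. sw h = i" if "descent n \<pi> i" for i
    using noncrossing_descent[OF N, of i] that by (force simp: descent_def)
  moreover have "\<exists>h'\<in>set H. \<exists>h''\<in>set H.
      descent n \<pi> (sw h') \<and> Suc (sw h'') = ne h \<and> ne h' = ne h \<and> ne h'' = ne h"
    if "h \<in> set H" for h
  proof -
    obtain i j where [simp]: "h = (i, j)" by (cases h)
    have "closed_at \<pi> (set H) j" using cl[of i j] that by simp
    then obtain i' where i': "(i', j) \<in> set H" "\<pi> (Suc i') < \<pi> i'" and j: "(j - 1, j) \<in> set H"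
      by (auto simp: closed_at_def)
    have "descent n \<pi> i'" using i' D[OF i'(1)] by (simp add: descent_def)
    moreover have "Suc (j - 1) = j" using D(2)[OF j] by simp
    ultimately show ?thesis
      using i'(1) j by (intro bexI[of _ "(i', j)"] bexI[of _ "(j - 1, j)"]) simp_all
  qed
  moreover have "span h \<subseteq> span h'" if h: "h \<in> set H" "h' \<in> set H" "\<pi> (ne h) < \<pi> (ne h')"
    and ov: "\<exists>x\<in>span h \<inter> span h'. \<exists>y\<in>span h \<inter> span h'. x \<noteq> y" for h h'
  proof -
    obtain i j i' j' where [simp]: "h = (i, j)" "h' = (i', j')" by (cases h, cases h')
    have ij: "(i, j) \<in> set H" "(i', j') \<in> set H" "\<pi> j < \<pi> j'" using h by simp_all
    have lt: "i < j'" "i' < j"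
      using ov span_overlap_iff[OF D(2)[OF ij(1)] D(2)[OF ij(2)]] by simp_all
    have "i' \<le> i"
    proof (rule ccontr)
      assume "\<not> i' \<le> i"
      \<comment> \<open>Otherwise the second hook would be nested in the first, although its end is
        higher.\<close>
      then have "j' \<le> j" using noncrossing_nested[OF N ij(1,2)] lt by simp
      then have "\<pi> j' \<le> \<pi> j" using noncrossing_le_NE[OF assms N ij(1)] lt by simp
      then show False using ij(3) by simp
    qed
    then have "j \<le> j'" using noncrossing_nested[OF N ij(2,1)] lt by simp
    then show ?thesis using \<open>i' \<le> i\<close> span_subset_iff[OF D(2)[OF ij(1)]] by simp
  qed
  ultimately show "H \<in> valid_hook_configs n \<pi>"
    using sorted unfolding valid_hook_configs_def by blast
qed

text \<open>By condition (a) the tuple is the set of its hooks sorted by their southwest endpoints,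
  which are distinct.\<close>

lemma bij_betw_set_valid_hook_configs:
  assumes "inj \<pi>"
  shows "bij_betw set (valid_hook_configs n \<pi>) (hook_sets \<pi> 1 n)"
proof (rule bij_betw_imageI)
  show "inj_on set (valid_hook_configs n \<pi>)"
  proof (rule inj_onI)
    fix H H' assume H: "H \<in> valid_hook_configs n \<pi>" "H' \<in> valid_hook_configs n \<pi>" "set H = set H'"
    then have "sorted (map sw H) \<and> distinct (map sw H)" "sorted (map sw H') \<and> distinct (map sw H')"
      by (simp_all add: valid_hook_configs_iff[OF assms] strict_sorted_iff)
    then show "H = H'"
      using H(3) by (intro map_sorted_distinct_set_unique[of sw]) (auto simp: distinct_map)
  qed
  show "set ` valid_hook_configs n \<pi> = hook_sets \<pi> 1 n"
  proof (intro equalityI subsetI)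
    fix S assume S: "S \<in> hook_sets \<pi> 1 n"
    then have N: "noncrossing \<pi> 1 n S" by (simp add: hook_sets_def)
    obtain H where H: "set H = S" "distinct H"
      using finite_distinct_list[OF noncrossing_finite[OF N]] by blast
    have "inj_on sw S" using noncrossing_fun[OF N] by (auto intro!: inj_onI)
    then have "sorted_wrt (<) (map sw (sort_key sw H))"
      using H by (simp add: strict_sorted_iff distinct_map)
    then have "sort_key sw H \<in> valid_hook_configs n \<pi>"
      using S H by (simp add: valid_hook_configs_iff[OF assms])
    then show "S \<in> set ` valid_hook_configs n \<pi>"
      using H by (intro image_eqI[of _ _ "sort_key sw H"]) simp_all
  qed (auto simp: valid_hook_configs_iff[OF assms])
qed

section \<open>Colour classes as uncovered positions\<close>

text \<open>The hooks whose top part meets the vertical line at \<open>k\<close>: strict on the left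
  because the top part begins half a unit after the southwest endpoint.\<close>

definition covering_hooks :: "hook list \<Rightarrow> nat \<Rightarrow> nat set" where
  "covering_hooks H k = {t\<in>{1..length H}. sw (nth_hook H t) < k \<and> k \<le> ne (nth_hook H t)}"

lemma nth_hook_mem: "t \<in> {1..length H} \<Longrightarrow> nth_hook H t \<in> set H"
  unfolding nth_hook_def by (intro nth_mem) auto

lemma mem_set_nth_hook: "h \<in> set H \<Longrightarrow> \<exists>t\<in>{1..length H}. nth_hook H t = h"
  unfolding in_set_conv_nth nth_hook_def by (force intro: bexI[of _ "Suc _"])

lemma sw_nth_hook_less_iff:
  assumes "sorted_wrt (<) (map sw H)" "s \<in> {1..length H}" "t \<in> {1..length H}"
  shows "sw (nth_hook H s) < sw (nth_hook H t) \<longleftrightarrow> s < t"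
proof -
  have less: "sw (nth_hook H s) < sw (nth_hook H t)"
    if "s < t" "s \<in> {1..length H}" "t \<in> {1..length H}" for s t
    using sorted_wrt_nth_less[OF assms(1), of "s - 1" "t - 1"] that by (auto simp: nth_hook_def)
  then show ?thesis using assms(2,3) by (metis less_asym less_irrefl linorder_neqE_nat)
qed

text \<open>By nesting, the lowest hook above a point is the covering hook that starts last; for a
  northeast endpoint this is the hook ending there that starts last.\<close>

lemma colour_eq_Max:
  assumes "inj \<pi>" and H: "H \<in> valid_hook_configs n \<pi>"
  shows "colour \<pi> H k = (if covering_hooks H k = {} then 0 else Max (covering_hooks H k))"
proof -
  have sorted: "sorted_wrt (<) (map sw H)" and N: "noncrossing \<pi> 1 n (set H)"
    and cl: "\<And>i j. (i, j) \<in> set H \<Longrightarrow> closed_at \<pi> (set H) j"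
    using H unfolding valid_hook_configs_iff[OF assms(1)] hook_sets_def by blast+
  note D = noncrossingD[OF N]
  note less = sw_nth_hook_less_iff[OF sorted]
  have mem: "(sw (nth_hook H t), ne (nth_hook H t)) \<in> set H" if "t \<in> {1..length H}" for t
    using nth_hook_mem[OF that] by simp
  have fin: "finite (covering_hooks H k)" by (simp add: covering_hooks_def)
  show ?thesis
  proof (cases "k \<in> ne ` set H")
    case True
    let ?R = "{r\<in>{1..length H}. ne (nth_hook H r) = k}"
    from True obtain i where "(i, k) \<in> set H" by auto
    \<comment> \<open>Condition (c) supplies a hook from \<open>k - 1\<close>, and no hook covering
      \<open>k\<close> can start further right.\<close>
    then have k: "(k - 1, k) \<in> set H" using cl by (auto simp: closed_at_def)
    then obtain t where t: "t \<in> {1..length H}" "nth_hook H t = (k - 1, k)"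
      using mem_set_nth_hook by blast
    have "?R \<subseteq> covering_hooks H k" using D(2)[OF mem] by (auto simp: covering_hooks_def)
    have max: "s \<le> t" if "s \<in> covering_hooks H k" for s
    proof -
      have s: "s \<in> {1..length H}" "sw (nth_hook H s) < k" using that by (auto simp: covering_hooks_def)
      then have "\<not> sw (nth_hook H t) < sw (nth_hook H s)" using t by simp
      then show ?thesis using less[OF t(1) s(1)] by simp
    qed
    have "t \<in> ?R" using t by simp
    then have "Max ?R = t"
      using \<open>?R \<subseteq> covering_hooks H k\<close> max by (intro Max_eqI) auto
    moreover have "Max (covering_hooks H k) = t" "covering_hooks H k \<noteq> {}"
      using \<open>?R \<subseteq> covering_hooks H k\<close> \<open>t \<in> ?R\<close> max fin by (auto intro!: Max_eqI)
    ultimately show ?thesis using True by (simp add: colour_def)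
  next
    case False
    \<comment> \<open>By \<open>noncrossing_le_NE\<close> a hook covering \<open>k\<close> passes
      above the point at \<open>k\<close>, so the height test in \<open>hooks_above\<close> is
      automatic.\<close>
    have above: "hooks_above \<pi> H k = covering_hooks H k"
    proof -
      have "(\<exists>y \<ge> real (\<pi> k). (real k, y) \<in> top_part \<pi> (nth_hook H t)) \<longleftrightarrow>
          sw (nth_hook H t) < k \<and> k \<le> ne (nth_hook H t)" if t: "t \<in> {1..length H}" for t
      proof -
        obtain i j where ij: "nth_hook H t = (i, j)" by (cases "nth_hook H t")
        have "(i, j) \<in> set H" using mem[OF t] ij by simp
        have "real i + 1 / 2 \<le> real k \<longleftrightarrow> i < k" by linarith
        moreover have "\<pi> k \<le> \<pi> j" if "i < k" "k \<le> j"
          using noncrossing_le_NE[OF assms(1) N \<open>(i, j) \<in> set H\<close> that] .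
        ultimately show ?thesis by (auto simp: ij top_part_def)
      qed
      then show ?thesis unfolding hooks_above_def covering_hooks_def by blast
    qed
    show ?thesis
    proof (cases "covering_hooks H k = {}")
      case True
      then show ?thesis using False above by (simp add: colour_def)
    next
      case nonempty: False
      define t where "t = Max (covering_hooks H k)"
      have t: "t \<in> covering_hooks H k" unfolding t_def by (rule Max_in[OF fin nonempty])
      have max: "s \<le> t" if "s \<in> covering_hooks H k" for s
        unfolding t_def by (rule Max_ge[OF fin that])
      have idx: "s \<in> {1..length H}" if "s \<in> covering_hooks H k" for s
        using that by (simp add: covering_hooks_def)
      have sw_max: "sw (nth_hook H s) \<le> sw (nth_hook H t)" if "s \<in> covering_hooks H k" for s
        using less[OF idx[OF t] idx[OF that]] max[OF that] by simp
      \<comment> \<open>The covering hook that starts last is nested in all the others, hence none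
        of them is lower.\<close>
      have "\<pi> (ne (nth_hook H t)) \<le> \<pi> (ne (nth_hook H s))" if s: "s \<in> covering_hooks H k" for s
      proof (rule noncrossing_le_NE[OF assms(1) N mem[OF idx[OF s]]])
        have "sw (nth_hook H t) < ne (nth_hook H s)"
          using s t by (simp add: covering_hooks_def)
        then show "ne (nth_hook H t) \<le> ne (nth_hook H s)"
          by (rule noncrossing_nested[OF N mem[OF idx[OF s]] mem[OF idx[OF t]] sw_max[OF s]])
        show "sw (nth_hook H s) < ne (nth_hook H t)"
          using s t by (simp add: covering_hooks_def)
      qed
      then have first: "t \<in> first_hooks_above \<pi> H k"
        using t by (auto simp: first_hooks_above_def is_arg_min_def above not_less)
      have sub: "s \<in> covering_hooks H k" if "s \<in> first_hooks_above \<pi> H k" for s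
        using that by (simp add: first_hooks_above_def is_arg_min_def above)
      have "(ARG_MAX (\<lambda>l. sw (nth_hook H l)) l. l \<in> first_hooks_above \<pi> H k) = t"
        unfolding arg_max_def
      proof (rule some_equality)
        show "is_arg_max (\<lambda>l. sw (nth_hook H l)) (\<lambda>l. l \<in> first_hooks_above \<pi> H k) t"
          using first sw_max sub by (auto simp: is_arg_max_def not_less)
        fix s assume "is_arg_max (\<lambda>l. sw (nth_hook H l)) (\<lambda>l. l \<in> first_hooks_above \<pi> H k) s"
        then have s: "s \<in> covering_hooks H k" "\<not> sw (nth_hook H s) < sw (nth_hook H t)"
          using first sub by (auto simp: is_arg_max_def)
        then show "s = t" using less[OF idx[OF s(1)] idx[OF t]] max[OF s(1)] by simp
      qed
      then show ?thesis using False nonempty above by (simp add: colour_def t_def)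
    qed
  qed
qed

text \<open>By \<open>colour_eq_Max\<close>, a point has the colour of a given hook exactly if that
  hook covers it and no hook starting further right does. It has colour 0 exactly if no hook covers
  it, as hooks are numbered from 1.\<close>

lemma q_eq_card_uncovered:
  assumes "inj \<pi>" and H: "H \<in> valid_hook_configs n \<pi>"
  shows "q n \<pi> H 0 = card (uncovered (set H) 1 n)"
    and "t \<in> {1..length H} \<Longrightarrow>
      q n \<pi> H t = card (uncovered (set H) (Suc (sw (nth_hook H t))) (ne (nth_hook H t)))"
proof -
  have sorted: "sorted_wrt (<) (map sw H)" and N: "noncrossing \<pi> 1 n (set H)"
    using H unfolding valid_hook_configs_iff[OF assms(1)] hook_sets_def by blast+
  note D = noncrossingD[OF N]
  have mem: "(sw (nth_hook H t), ne (nth_hook H t)) \<in> set H" if "t \<in> {1..length H}" for t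
    using nth_hook_mem[OF that] by simp
  have fin: "finite (covering_hooks H k)" for k by (simp add: covering_hooks_def)
  \<comment> \<open>Injectivity of \<open>\<pi>\<close> allows counting positions in place of
    entries.\<close>
  have q: "q n \<pi> H t = card {k\<in>{1..n}. colour \<pi> H k = t}" for t
    unfolding q_def Q_def using assms(1) by (intro card_image) (auto intro: inj_on_subset)
  have "colour \<pi> H k = 0 \<longleftrightarrow> k \<in> uncovered (set H) 1 n" if k: "k \<in> {1..n}" for k
  proof -
    have "Max (covering_hooks H k) \<noteq> 0" if "covering_hooks H k \<noteq> {}"
      using Max_in[OF fin that] by (simp add: covering_hooks_def)
    then have "colour \<pi> H k = 0 \<longleftrightarrow> covering_hooks H k = {}"
      by (simp add: colour_eq_Max[OF assms])
    also have "\<dots> \<longleftrightarrow> (\<forall>h\<in>set H. \<not> (sw h < k \<and> k \<le> ne h))"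
      unfolding covering_hooks_def using mem_set_nth_hook nth_hook_mem by blast
    also have "\<dots> \<longleftrightarrow> k \<in> uncovered (set H) 1 n"
      using k D(1) unfolding uncovered_def by fastforce
    finally show ?thesis .
  qed
  then have "{k\<in>{1..n}. colour \<pi> H k = 0} = uncovered (set H) 1 n"
    by (auto simp: uncovered_def)
  then show "q n \<pi> H 0 = card (uncovered (set H) 1 n)" by (simp add: q)
  assume t: "t \<in> {1..length H}"
  let ?i = "sw (nth_hook H t)" and ?j = "ne (nth_hook H t)"
  have "colour \<pi> H k = t \<longleftrightarrow> k \<in> uncovered (set H) (Suc ?i) ?j" for k
  proof -
    have "colour \<pi> H k = t \<longleftrightarrow> t \<in> covering_hooks H k \<and> (\<forall>s\<in>covering_hooks H k. s \<le> t)"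
      using t Max_eq_iff[OF fin, of k t] by (auto simp: colour_eq_Max[OF assms])
    also have "\<dots> \<longleftrightarrow> ?i < k \<and> k \<le> ?j \<and>
        (\<forall>s\<in>{1..length H}. sw (nth_hook H s) < k \<longrightarrow> k \<le> ne (nth_hook H s) \<longrightarrow>
          \<not> ?i < sw (nth_hook H s))"
      using t sw_nth_hook_less_iff[OF sorted t] by (auto simp: covering_hooks_def not_less)
    also have "\<dots> \<longleftrightarrow> ?i < k \<and> k \<le> ?j \<and> (\<forall>h\<in>set H. sw h < k \<longrightarrow> k \<le> ne h \<longrightarrow> \<not> ?i < sw h)"
      using mem_set_nth_hook nth_hook_mem by metis
    also have "\<dots> \<longleftrightarrow> k \<in> uncovered (set H) (Suc ?i) ?j"
      unfolding uncovered_def by fastforce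
    finally show ?thesis .
  qed
  moreover have "uncovered (set H) (Suc ?i) ?j \<subseteq> {1..n}"
    using D(3)[OF mem[OF t]] by (auto simp: uncovered_def)
  ultimately have "{k\<in>{1..n}. colour \<pi> H k = t} = uncovered (set H) (Suc ?i) ?j" by blast
  then show "q n \<pi> H t = card (uncovered (set H) (Suc ?i) ?j)" by (simp add: q)
qed

text \<open>Colour 0 is split off, and the other colours are reindexed by the hooks themselves,
  which are distinct.\<close>

lemma prod_catalan_eq_weight:
  assumes "inj \<pi>" and H: "H \<in> valid_hook_configs n \<pi>"
  shows "(\<Prod>t=0..length H. catalan (q n \<pi> H t - 1)) = weight 1 n (set H)"
proof -
  let ?f = "\<lambda>h. catalan (card (uncovered (set H) (Suc (sw h)) (ne h)) - 1)"
  have "distinct H"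
    using H strict_sorted_iff[of "map sw H"]
    by (simp add: valid_hook_configs_iff[OF assms(1)] distinct_map)
  have "{0..length H} = insert 0 {1..length H}" by auto
  then have "(\<Prod>t=0..length H. catalan (q n \<pi> H t - 1)) =
      catalan (q n \<pi> H 0 - 1) * (\<Prod>t\<in>{1..length H}. catalan (q n \<pi> H t - 1))"
    by simp
  also have "(\<Prod>t\<in>{1..length H}. catalan (q n \<pi> H t - 1)) = (\<Prod>t\<in>{1..length H}. ?f (nth_hook H t))"
    by (intro prod.cong refl) (simp only: q_eq_card_uncovered(2)[OF assms])
  also have "\<dots> = (\<Prod>t<length H. ?f (H ! t))"
    by (rule prod.reindex_bij_witness[of _ Suc "\<lambda>t. t - 1"]) (auto simp: nth_hook_def)
  also have "\<dots> = hook_weight (set H)"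
    unfolding hook_weight_def
    by (rule prod.reindex_bij_betw[OF bij_betw_nth[OF \<open>distinct H\<close> refl refl]])
  finally show ?thesis by (simp only: weight_def q_eq_card_uncovered(1)[OF assms])
qed

theorem theorem3p2:
  fixes n :: nat and \<pi> :: "nat \<Rightarrow> nat"
  assumes "n \<ge> 1" and "\<pi> permutes {1..n}"
  shows "card {t \<in> decreasing_ntrees_on {1..n}. postorder t = word n \<pi>} =
    (\<Sum>H\<in>valid_hook_configs n \<pi>. \<Prod>t=0..length H. catalan (q n \<pi> H t - 1))"
proof -
  have inj: "inj \<pi>" using assms(2) by (rule permutes_inj)
  have "distinct (word n \<pi>)" "set (word n \<pi>) = {1..n}"
    using permutes_inj_on[OF assms(2)] permutes_image[OF assms(2)]
    by (simp_all add: word_def distinct_map atLeastLessThanSuc_atLeastAtMost del: upt_Suc)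
  \<comment> \<open>A tree whose postorder is this word is labelled bijectively by
    \<open>{1..n}\<close>, since the word lists that set without repetition.\<close>
  then have "{t \<in> decreasing_ntrees_on {1..n}. postorder t = word n \<pi>} = word_trees \<pi> 1 n"
    by (auto simp: decreasing_ntrees_on_def word_trees_def word_def simp del: upt_Suc)
  then have "card {t \<in> decreasing_ntrees_on {1..n}. postorder t = word n \<pi>} =
      (\<Sum>S\<in>hook_sets \<pi> 1 n. weight 1 n S)"
    using card_word_trees_eq_sum_weight[OF inj assms(1)] by simp
  also have "\<dots> = (\<Sum>H\<in>valid_hook_configs n \<pi>. weight 1 n (set H))"
    by (rule sum.reindex_bij_betw[OF bij_betw_set_valid_hook_configs[OF inj], symmetric])
  also have "\<dots> = (\<Sum>H\<in>valid_hook_configs n \<pi>. \<Prod>t=0..length H. catalan (q n \<pi> H t - 1))"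
    by (intro sum.cong refl prod_catalan_eq_weight[OF inj, symmetric])
  finally show ?thesis .
qed

end
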